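(* Let $S$ be a finite entire antinegative semiring with $|S|\geq 3$, let $n\geq 2$ be an integer, and let $\mathcal{B}$ be the binary Boolean semiring. Then $$\dim_M(\Gamma(M_n(S)))=|S|^{n^2}-2^{n^2}-\sum_{k=0}^{n}(-1)^k\binom{n}{k}\left[\left(|S|^{n-k}-1\right)^{n}-\left(2^{n-k}-1\right)^{n}\right]+\dim_M(\Gamma(M_n(\mathcal{B})))-2(n-1).$$
   Context: A semiring is a set $S$ with operations $+,\cdot$ such that $(S,+)$ is a commutative monoid with identity $0$, $(S,\cdot)$ is a monoid with identity $1$, multiplication distributes over addition on both sides, and $0\cdot a=a\cdot 0=0$ for all $a$. It is entire if $ab=0$ implies $a=0$ or $b=0$, and antinegative (an "antiring") if $a+b=0$ implies $a=b=0$. The binary Boolean semiring $\mathcal{B}$ is $\{0,1\}$ with addition and multiplication as in $\mathbb{Z}$ except that $1+1=1$. $M_n(S)$ is the semiring of $n\times n$ matrices over $S$. For a semiring $T$, let $Z(T)=\{x\in T : \text{there exists } 0\neq y\in T \text{ with } xy=0 \text{ or } yx=0\}$. The zero-divisor graph $\Gamma(T)$ is the simple undirected graph with vertex set $Z(T)\setminus\{0\}$, in which distinct vertices $x,y$ are adjacent iff $xy=0$ or $yx=0$. The distance $d(x,y)$ is the length of a shortest path. A set $W=\{w_1,\dots,w_k\}$ of vertices of a graph $G$ is a resolving set for $G$ if distinct vertices $v$ of $G$ have distinct vectors $(d(v,w_1),\dots,d(v,w_k))$. The metric dimension $\dim_M(G)$ is the minimal cardinality of a resolving set for $G$. *)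

theory Defs
  imports
    "HOL-Library.Cardinality"
    "Graph_Theory.Pair_Digraph"
    "Graph_Theory.Shortest_Path"
    "Jordan_Normal_Form.Matrix"
begin

section \<open>Antinegative semirings and the binary Boolean semiring\<close>

text \<open>
  The class \<^class>\<open>semiring_1\<close> includes \<open>0 \<noteq> 1\<close>, which holds in every semiring with at
  least two elements. Entire semirings are the class \<^class>\<open>semiring_1_no_zero_divisors\<close>.
\<close>

definition antinegative :: "'a::semiring_1 itself \<Rightarrow> bool" where
  "antinegative S \<longleftrightarrow> (\<forall>a b :: 'a. a + b = 0 \<longrightarrow> a = 0 \<and> b = 0)"

datatype boolean = BZero | BOne

instantiation boolean :: comm_semiring_1
begin

definition "0 = BZero"
definition "1 = BOne"
definition "x + y = (if x = BZero \<and> y = BZero then BZero else BOne)"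
definition "x * y = (if x = BOne \<and> y = BOne then BOne else BZero)"

instance
proof
  fix a b c :: boolean
  show "a + b + c = a + (b + c)" "a + b = b + a" "0 + a = a"
    "a * b * c = a * (b * c)" "a * b = b * a" "1 * a = a"
    "(a + b) * c = a * c + b * c" "0 * a = 0" "a * 0 = 0" "(0::boolean) \<noteq> 1"
    by (cases a; cases b; cases c;
        simp add: zero_boolean_def one_boolean_def plus_boolean_def times_boolean_def)+
qed

end

lemma UNIV_boolean: "(UNIV :: boolean set) = {0, 1}"
  using boolean.exhaust by (auto simp: zero_boolean_def one_boolean_def)

instance boolean :: finite
  by standard (simp add: UNIV_boolean)

lemma one_plus_one_boolean: "(1::boolean) + 1 = 1"
  by (simp add: one_boolean_def plus_boolean_def)


section \<open>Zero-divisor graphs\<close>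

definition zero_divisors :: "('a, 'b) ring_scheme \<Rightarrow> 'a set" where
  "zero_divisors T = {x \<in> carrier T. \<exists>y \<in> carrier T. y \<noteq> \<zero>\<^bsub>T\<^esub> \<and>
     (x \<otimes>\<^bsub>T\<^esub> y = \<zero>\<^bsub>T\<^esub> \<or> y \<otimes>\<^bsub>T\<^esub> x = \<zero>\<^bsub>T\<^esub>)}"

text \<open>
  An undirected simple graph is a symmetric loop-free digraph without parallel arcs: the edge
  joining \<open>x\<close> and \<open>y\<close> is the pair of arcs \<open>(x, y)\<close>, \<open>(y, x)\<close>.
\<close>

definition zero_divisor_graph :: "('a, 'b) ring_scheme \<Rightarrow> 'a pair_pre_digraph" where
  "zero_divisor_graph T =
     \<lparr> pverts = zero_divisors T - {\<zero>\<^bsub>T\<^esub>},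
       parcs = {(x, y). x \<in> zero_divisors T - {\<zero>\<^bsub>T\<^esub>} \<and> y \<in> zero_divisors T - {\<zero>\<^bsub>T\<^esub>} \<and>
                  x \<noteq> y \<and> (x \<otimes>\<^bsub>T\<^esub> y = \<zero>\<^bsub>T\<^esub> \<or> y \<otimes>\<^bsub>T\<^esub> x = \<zero>\<^bsub>T\<^esub>)} \<rparr>"

lemma pair_graph_zero_divisor_graph:
  assumes "finite (carrier T)"
  shows "pair_graph (zero_divisor_graph T)"
proof -
  have fin: "finite (pverts (zero_divisor_graph T))"
    by (rule finite_subset[OF _ assms]) (auto simp: zero_divisor_graph_def zero_divisors_def)
  have sub: "parcs (zero_divisor_graph T)
      \<subseteq> pverts (zero_divisor_graph T) \<times> pverts (zero_divisor_graph T)"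
    by (auto simp: zero_divisor_graph_def)
  have finp: "finite (parcs (zero_divisor_graph T))"
    by (rule finite_subset[OF sub]) (simp add: fin)
  show ?thesis
    by unfold_locales
      (rule fin finp | force simp: zero_divisor_graph_def symmetric_def sym_def)+
qed


section \<open>Metric dimension\<close>

text \<open>
  The distance is the minimal cost of a walk when every arc has weight 1, i.e. the length of a
  shortest path; it is \<open>\<infinity>\<close> if there is none. The constant
  \<^const>\<open>wf_digraph.\<mu>\<close> is specified only for well-formed \<open>G\<close>.
\<close>

definition graph_dist :: "('a, 'b) pre_digraph \<Rightarrow> 'a \<Rightarrow> 'a \<Rightarrow> ereal" where
  "graph_dist G u v = wf_digraph.\<mu> G (\<lambda>_. 1) u v"

lemma graph_dist_eq:
  assumes "wf_digraph G"
  shows "graph_dist G u v = (INF p \<in> {p. pre_digraph.awalk G u p v}. ereal (real (length p)))"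
proof -
  interpret wf_digraph G by fact
  have "awalk_cost (\<lambda>_. 1) p = real (length p)" for p
    by (induction p) auto
  then show ?thesis
    by (simp add: graph_dist_def \<mu>_def)
qed

definition resolving_set :: "('a, 'b) pre_digraph \<Rightarrow> 'a set \<Rightarrow> bool" where
  "resolving_set G W \<longleftrightarrow> finite W \<and> W \<subseteq> verts G \<and>
     (\<forall>u \<in> verts G. \<forall>v \<in> verts G. u \<noteq> v \<longrightarrow> (\<exists>w \<in> W. graph_dist G u w \<noteq> graph_dist G v w))"

text \<open>The set of cardinalities below is nonempty for every finite graph, as all vertices together
  form a resolving set.\<close>

definition metric_dimension :: "('a, 'b) pre_digraph \<Rightarrow> nat" where
  "metric_dimension G = (LEAST k. \<exists>W. resolving_set G W \<and> card W = k)"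

end

theory Submission
  imports Defs
begin

text \<open>
  In an entire antinegative semiring \<open>A * B = 0\<close> depends only on the sets of nonzero rows and nonzero
  columns: no nonzero column of \<open>A\<close> may be the index of a nonzero row of \<open>B\<close>. Hence the distance of
  two distinct vertices is a function of their patterns (nonzero rows, nonzero columns), and a
  resolving set omits at most one vertex of each pattern. If the semiring has at least three elements,
  each pattern is carried by at least two matrices, so one vertex of each pattern can be omitted,
  since the remaining ones realise all patterns. Over the Boolean semiring the patterns with a
  single nonzero row or column are carried by just one matrix, and exactly \<open>2 * (n - 1)\<close> of these
  must be kept. The vertices are counted by inclusion-exclusion over the zero columns of matrices
  without zero rows.
\<close>

section \<open>Patterns and their distances\<close>

text \<open>Let \<open>Q\<close> be the set of patterns of the vertices omitted from a resolving set
  \<open>W\<close>. The size of \<open>W\<close> is the number of vertices minus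
  \<open>card Q\<close>, so a small \<open>W\<close> means a large \<open>Q\<close>. The constraint
  is that the patterns still present in \<open>W\<close> separate \<open>Q\<close>, and a pattern
  can be both a test and omitted only if it has two carriers. With a third semiring element this
  never obstructs. Over the Boolean semiring a pattern with a single nonzero row or column has to
  choose one of the two roles. Patterns with the same single row that lack just one column each are
  told apart only by tests with a single nonzero row. Two such patterns differ at two indices, so
  one index may go untested: hence \<open>n - 1\<close> tests for columns and, by transposition,
  \<open>n - 1\<close> for rows. The delicate point of the lower bound is that a test
  \<open>({k}, {l})\<close> could serve both purposes at once. The number of patterns does not
  depend on the semiring; it cancels in the difference of the two dimensions and is never
  computed.\<close>

definition patterns :: "nat \<Rightarrow> (nat set \<times> nat set) set" where
  "patterns n = {(R, C). R \<subseteq> {..<n} \<and> C \<subseteq> {..<n} \<and> R \<noteq> {} \<and> C \<noteq> {} \<and>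
     \<not> (R = {..<n} \<and> C = {..<n})}"

text \<open>
  A pattern \<open>(R, C)\<close> records the nonzero rows and the nonzero columns of a zero divisor.
  The distance below is the graph distance of two distinct vertices with the given patterns,
  in particular it is not 0 on the diagonal.
\<close>

fun pattern_dist :: "nat \<Rightarrow> nat set \<times> nat set \<Rightarrow> nat set \<times> nat set \<Rightarrow> nat" where
  "pattern_dist n (R, C) (X, Y) =
     (if C \<inter> X = {} \<or> R \<inter> Y = {} then 1
      else if C \<noteq> {..<n} \<and> X \<noteq> {..<n} \<or> R \<noteq> {..<n} \<and> Y \<noteq> {..<n} \<or>
        C \<union> Y \<noteq> {..<n} \<or> R \<union> X \<noteq> {..<n} then 2
      else 3)"

definition separates :: "nat \<Rightarrow> (nat set \<times> nat set) set \<Rightarrow> (nat set \<times> nat set) set \<Rightarrow> bool" where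
  "separates n P Q \<longleftrightarrow>
     (\<forall>p \<in> Q. \<forall>q \<in> Q. p \<noteq> q \<longrightarrow> (\<exists>t \<in> P. pattern_dist n p t \<noteq> pattern_dist n q t))"

lemma separatesD:
  assumes "separates n P Q" "p \<in> Q" "q \<in> Q" "p \<noteq> q"
  obtains t where "t \<in> P" "pattern_dist n p t \<noteq> pattern_dist n q t"
  using assms unfolding separates_def by blast

lemma separates_mono: "separates n P Q \<Longrightarrow> P \<subseteq> P' \<Longrightarrow> Q' \<subseteq> Q \<Longrightarrow> separates n P' Q'"
  unfolding separates_def by (meson subsetD)

lemma finite_patterns: "finite (patterns n)"
  by (rule finite_subset[of _ "Pow {..<n} \<times> Pow {..<n}"]) (auto simp: patterns_def)

lemma swap_patterns_iff [simp]: "prod.swap p \<in> patterns n \<longleftrightarrow> p \<in> patterns n"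
  by (cases p) (auto simp: patterns_def)

lemma pattern_dist_swap [simp]:
  "pattern_dist n (prod.swap p) (prod.swap q) = pattern_dist n p q"
  by (cases p; cases q) auto

lemma eq_singleton_if_card_less_2:
  assumes "finite A" "a \<in> A" "\<not> card A \<ge> 2"
  shows "A = {a}"
proof -
  have "card A \<noteq> 0" using assms(1,2) by auto
  with assms(3) have "card A = 1" by linarith
  then show ?thesis using assms(2) by (auto simp: card_1_singleton_iff)
qed

lemma lessThan_neq_singleton:
  assumes "n \<ge> 2" shows "{..<n :: nat} \<noteq> {i}"
proof
  assume "{..<n} = {i}"
  then have "card {..<n} = card {i}" by simp
  then show False using assms by simp
qed

text \<open>Transposition exchanges rows and columns and preserves \<open>pattern_dist\<close>, so
  only patterns with different column sets need a test. Some index then lies in exactly one of the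
  two column sets, and it may be taken to lie in that of \<open>q\<close>.\<close>

lemma separates_by_symmetry:
  assumes P: "\<And>p. prod.swap p \<in> P \<longleftrightarrow> p \<in> P" and Q: "\<And>p. prod.swap p \<in> Q \<longleftrightarrow> p \<in> Q"
    and sep: "\<And>p q i. p \<in> Q \<Longrightarrow> q \<in> Q \<Longrightarrow> i \<in> snd q \<Longrightarrow> i \<notin> snd p \<Longrightarrow>
      \<exists>t \<in> P. pattern_dist n p t \<noteq> pattern_dist n q t"
  shows "separates n P Q"
  unfolding separates_def
proof (intro ballI impI)
  have snd: "\<exists>t \<in> P. pattern_dist n p t \<noteq> pattern_dist n q t"
    if "p \<in> Q" "q \<in> Q" "snd p \<noteq> snd q" for p q
  proof -
    from that(3) obtain i where "i \<in> snd q \<and> i \<notin> snd p \<or> i \<in> snd p \<and> i \<notin> snd q" by blast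
    then show ?thesis using sep[of p q i] sep[of q p i] that(1,2) by metis
  qed
  fix p q
  assume pq: "p \<in> Q" "q \<in> Q" "p \<noteq> q"
  show "\<exists>t \<in> P. pattern_dist n p t \<noteq> pattern_dist n q t"
  proof (cases "snd p = snd q")
    case False
    then show ?thesis using snd pq by blast
  next
    case True
    then have "snd (prod.swap p) \<noteq> snd (prod.swap q)" using pq(3) by (simp add: prod_eq_iff)
    moreover have "prod.swap p \<in> Q" "prod.swap q \<in> Q" using pq Q by simp_all
    ultimately obtain t where t: "t \<in> P"
      "pattern_dist n (prod.swap p) t \<noteq> pattern_dist n (prod.swap q) t"
      using snd by blast
    have "prod.swap t \<in> P" using t(1) P by simp
    moreover have "pattern_dist n p (prod.swap t) \<noteq> pattern_dist n q (prod.swap t)"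
      using t(2) by (metis pattern_dist_swap swap_swap)
    ultimately show ?thesis by blast
  qed
qed

section \<open>A separating family of tests for the Boolean semiring\<close>

definition thick_patterns :: "nat \<Rightarrow> (nat set \<times> nat set) set" where
  "thick_patterns n = {p \<in> patterns n. card (fst p) \<ge> 2 \<and> card (snd p) \<ge> 2}"

text \<open>The index \<open>n - 1\<close> is left out on purpose: these tests only have to tell
  apart complements of two different singletons, and at least one of the two missing indices is
  below \<open>n - 1\<close>.\<close>

definition thin_tests :: "nat \<Rightarrow> (nat set \<times> nat set) set" where
  "thin_tests n = (\<lambda>i. ({i}, {..<n})) ` {..<n - 1} \<union> (\<lambda>i. ({..<n}, {i})) ` {..<n - 1}"

lemma swap_thick_patterns_iff [simp]: "prod.swap p \<in> thick_patterns n \<longleftrightarrow> p \<in> thick_patterns n"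
  by (auto simp: thick_patterns_def)

lemma swap_thin_tests_iff [simp]: "prod.swap p \<in> thin_tests n \<longleftrightarrow> p \<in> thin_tests n"
  by (cases p) (auto simp: thin_tests_def)

lemma thin_tests_subset_patterns:
  assumes "n \<ge> 2" shows "thin_tests n \<subseteq> patterns n"
proof -
  note lessThan_neq_singleton[OF assms]
  then show ?thesis
    using assms by (auto simp: thin_tests_def patterns_def lessThan_empty_iff)
qed

lemma card_thin_tests:
  assumes "n \<ge> 2" shows "card (thin_tests n) = 2 * (n - 1)"
proof -
  note lessThan_neq_singleton[OF assms]
  then have "(\<lambda>i. ({i}, {..<n})) ` {..<n - 1} \<inter> (\<lambda>i. ({..<n}, {i})) ` {..<n - 1} = {}"
    by auto
  moreover have "inj_on (\<lambda>i. ({i}, {..<n})) {..<n - 1}" "inj_on (\<lambda>i. ({..<n}, {i})) {..<n - 1}"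
    by (auto simp: inj_on_def)
  ultimately show ?thesis
    unfolding thin_tests_def by (subst card_Un_disjoint) (auto simp: card_image)
qed

lemma full_col_test_in_thick:
  assumes "X \<subseteq> {..<n}" "X \<noteq> {..<n}" "card X \<ge> 2"
  shows "(X, {..<n}) \<in> thick_patterns n"
proof -
  have "card X \<le> n" using card_mono[OF _ assms(1)] by simp
  moreover have "X \<noteq> {}" using assms(3) by auto
  ultimately show ?thesis using assms by (auto simp: thick_patterns_def patterns_def)
qed

text \<open>A proper \<open>X\<close> with \<open>R \<union> X = {..<n}\<close> puts the pattern
  \<open>(R, {..<n})\<close> at distance 3 from the test \<open>(X, {..<n})\<close>. For
  \<open>n = 2\<close> and \<open>R = {0}\<close> the only candidate is \<open>X = {1}\<close>,
  whose test is neither thick nor thin in the sense of \<open>thin_tests\<close>, hence the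
  exception.\<close>

lemma ex_test_covering:
  assumes n: "n \<ge> 2" and R: "R \<subseteq> {..<n}" "R \<noteq> {..<n}" "R \<noteq> {}"
    and R0: "n = 2 \<Longrightarrow> R \<noteq> {0}"
  obtains X where "X \<subseteq> {..<n}" "X \<noteq> {..<n}" "X \<noteq> {}" "R \<union> X = {..<n}"
    "(X, {..<n}) \<in> thick_patterns n \<union> thin_tests n"
proof (cases "card ({..<n} - R) \<ge> 2")
  case True
  have "{..<n} - R \<noteq> {..<n}" "{..<n} - R \<noteq> {}" "R \<union> ({..<n} - R) = {..<n}" using R by blast+
  moreover from this(1) True have "({..<n} - R, {..<n}) \<in> thick_patterns n"
    by (intro full_col_test_in_thick) auto
  ultimately show thesis using that by blast
next
  case False
  from R obtain j where j: "j \<in> {..<n} - R" by blast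
  with False have "{..<n} - R = {j}" by (intro eq_singleton_if_card_less_2) auto
  then have R': "R = {..<n} - {j}" using R by blast
  show thesis
  proof (cases "n = 2")
    case True
    have "j = 0"
    proof (rule ccontr)
      assume "j \<noteq> 0"
      then have "j = 1" using j True by auto
      then have "R = {0}" using R' True by auto
      then show False using R0 True by blast
    qed
    moreover have "({0}, {..<n}) \<in> thin_tests n" using True by (auto simp: thin_tests_def)
    ultimately show thesis using R' j lessThan_neq_singleton[OF n, of 0] by (intro that[of "{0}"]) auto
  next
    case False
    \<comment> \<open>Any index other than \<open>j\<close> will do: it enlarges \<open>{j}\<close>
      to a pair, whose test is thick, whereas \<open>({j}, {..<n})\<close> is no thin test if
      \<open>j\<close> is the last index.\<close>
    define i where "i = (if j = 0 then 1 else 0 :: nat)"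
    have ij: "i \<noteq> j" "i < n" "j < n" using n j by (auto simp: i_def)
    then have c: "card {i, j} = 2" by simp
    have "{i, j} \<noteq> {..<n}" using c False by (metis card_lessThan)
    moreover from this c ij have "({i, j}, {..<n}) \<in> thick_patterns n"
      by (intro full_col_test_in_thick) auto
    ultimately show thesis using ij R' by (intro that[of "{i, j}"]) auto
  qed
qed

lemma pattern_dist_full_col_test:
  assumes "(R, C) \<in> patterns n"
  shows "pattern_dist n (R, C) (X, {..<n}) = 1 \<longleftrightarrow> C \<inter> X = {}"
proof -
  have "R \<inter> {..<n} \<noteq> {}" using assms by (auto simp: patterns_def)
  then show ?thesis by simp
qed

text \<open>A test \<open>(X, {..<n})\<close> is at distance 1 from exactly those patterns whose
  column set avoids \<open>X\<close>. If \<open>C'\<close> is full, nonempty sets are never avoided,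
  and distance 3 is used instead: it is attained for \<open>(R', C')\<close>, but not for
  \<open>(R, C)\<close>, since \<open>C\<close> and \<open>X\<close> are both proper. Otherwise the
  complement of \<open>C\<close> or of \<open>C'\<close> serves as \<open>X\<close>, as long as one
  of them has two elements.\<close>

lemma ex_separating_test:
  assumes n: "n \<ge> 2"
    and p: "(R, C) \<in> patterns n" and q: "(R', C') \<in> patterns n - thin_tests n"
    and k: "k \<in> C'" "k \<notin> C"
  shows "\<exists>t \<in> thick_patterns n \<union> thin_tests n. pattern_dist n (R, C) t \<noteq> pattern_dist n (R', C') t"
proof -
  let ?N = "{..<n}"
  let ?P = "thick_patterns n \<union> thin_tests n"
  have q': "(R', C') \<in> patterns n" using q by blast
  have sub: "R \<subseteq> ?N" "C \<subseteq> ?N" "C \<noteq> {}" "R' \<subseteq> ?N" "C' \<subseteq> ?N" "R' \<noteq> {}" "C' \<noteq> {}"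
    using p q' by (simp_all add: patterns_def)
  have Cne: "C \<noteq> ?N" using k sub by blast
  have disj: ?thesis if "(X, ?N) \<in> ?P" "C \<inter> X = {} \<longleftrightarrow> C' \<inter> X \<noteq> {}" for X
    using that pattern_dist_full_col_test[OF p, of X] pattern_dist_full_col_test[OF q', of X] by metis
  show ?thesis
  proof (cases "C' = ?N")
    case True
    then have R': "R' \<noteq> ?N" using q' unfolding patterns_def by blast
    have R0: "R' \<noteq> {0}" if "n = 2"
    proof -
      have "({0}, ?N) \<in> thin_tests n" using that by (auto simp: thin_tests_def)
      then show ?thesis using q True by blast
    qed
    obtain X where X: "X \<subseteq> ?N" "X \<noteq> ?N" "X \<noteq> {}" "R' \<union> X = ?N" and t: "(X, ?N) \<in> ?P"
      using ex_test_covering[OF n sub(4) R' sub(6) R0] by blast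
    have "C' \<inter> X \<noteq> {}" "R' \<inter> ?N \<noteq> {}" using X True sub by blast+
    then have "pattern_dist n (R', C') (X, ?N) = 3" using True X(2,4) by simp
    moreover have "pattern_dist n (R, C) (X, ?N) \<le> 2" using X(2) Cne by simp
    ultimately show ?thesis using t by force
  next
    case C': False
    show ?thesis
    proof (cases "card (?N - C) \<ge> 2")
      case True
      have "?N - C \<noteq> ?N" using sub by blast
      then have "(?N - C, ?N) \<in> ?P" using True full_col_test_in_thick[of "?N - C" n] by blast
      moreover have "C' \<inter> (?N - C) \<noteq> {}" using k sub by blast
      ultimately show ?thesis by (intro disj) auto
    next
      case False
      have "k \<in> ?N - C" using k sub by blast
      then have C: "?N - C = {k}" using False by (intro eq_singleton_if_card_less_2) auto
      show ?thesis
      proof (cases "card (?N - C') \<ge> 2")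
        case True
        have "?N - C' \<noteq> ?N" using sub by blast
        then have "(?N - C', ?N) \<in> ?P" using True full_col_test_in_thick[of "?N - C'" n] by blast
        moreover have "C \<inter> (?N - C') \<noteq> {}"
        proof
          assume "C \<inter> (?N - C') = {}"
          then have "?N - C' \<subseteq> ?N - C" by blast
          then show False using True C card_mono[of "?N - C" "?N - C'"] by simp
        qed
        ultimately show ?thesis by (intro disj) auto
      next
        case False
        obtain l where l: "l \<in> ?N - C'" using C' sub by blast
        then have "?N - C' = {l}" using False by (intro eq_singleton_if_card_less_2) auto
        then have mem: "l \<in> C" "l \<notin> C'" "k \<noteq> l" "k < n" "l < n" using k l C sub by auto
        \<comment> \<open>The column sets are now the complements of \<open>{k}\<close> and
          \<open>{l}\<close>. An \<open>X\<close> with two elements meets both, so a singleton is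
          forced; as \<open>k \<noteq> l\<close>, one of them is below \<open>n - 1\<close>.\<close>
        define i where "i = (if k < n - 1 then k else l)"
        have "i < n - 1" using mem by (auto simp: i_def)
        then have "({i}, ?N) \<in> ?P" by (auto simp: thin_tests_def)
        moreover have "C \<inter> {i} = {} \<longleftrightarrow> C' \<inter> {i} \<noteq> {}" using mem k by (auto simp: i_def)
        ultimately show ?thesis by (rule disj)
      qed
    qed
  qed
qed

lemma separates_thick_Un_thin:
  assumes n: "n \<ge> 2"
  shows "separates n (thick_patterns n \<union> thin_tests n) (patterns n - thin_tests n)"
proof (rule separates_by_symmetry)
  fix p q i
  assume "p \<in> patterns n - thin_tests n" "q \<in> patterns n - thin_tests n" "i \<in> snd q" "i \<notin> snd p"
  then show "\<exists>t \<in> thick_patterns n \<union> thin_tests n. pattern_dist n p t \<noteq> pattern_dist n q t"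
    using ex_separating_test[OF n, of "fst p" "snd p" "fst q" "snd q" i] by simp
qed simp_all

lemma separates_patterns:
  assumes n: "n \<ge> 2"
  shows "separates n (patterns n) (patterns n)"
proof (rule separates_by_symmetry)
  fix p q i
  assume p: "p \<in> patterns n" and q: "q \<in> patterns n" and i: "i \<in> snd q" "i \<notin> snd p"
  obtain R C R' C' where e: "p = (R, C)" "q = (R', C')" by fastforce
  have ne: "R \<inter> {..<n} \<noteq> {}" "R' \<inter> {..<n} \<noteq> {}" using p q by (auto simp: patterns_def e)
  have "({i}, {..<n}) \<in> patterns n"
    using i q lessThan_neq_singleton[OF n, of i] n by (auto simp: patterns_def e)
  moreover have "pattern_dist n p ({i}, {..<n}) \<noteq> pattern_dist n q ({i}, {..<n})"
    using i ne by (simp add: e)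
  ultimately show "\<exists>t \<in> patterns n. pattern_dist n p t \<noteq> pattern_dist n q t" by blast
qed simp_all

section \<open>The lower bound over the Boolean semiring\<close>

text \<open>
  If \<open>n \<ge> 3\<close>, two patterns \<open>({j}, {..<n} - {k})\<close> and \<open>({j}, {..<n} - {k'})\<close> are told apart only
  by tests \<open>({k}, Y)\<close> or \<open>({k'}, Y)\<close> with \<open>j \<in> Y\<close>. So for each \<open>j\<close> all but at most one \<open>k\<close> must be hit, by
  such a test or because \<open>({j}, {..<n} - {k})\<close> itself is not to be resolved.
\<close>

definition hits :: "nat \<Rightarrow> nat \<Rightarrow> nat \<Rightarrow> (nat set \<times> nat set) set \<Rightarrow> bool" where
  "hits n j k E \<longleftrightarrow> (\<exists>Y. ({k}, Y) \<in> E \<and> j \<in> Y) \<or> ({j}, {..<n} - {k}) \<in> E"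

text \<open>
  The witness \<open>t\<close> is the number of \<open>k\<close> for which no \<open>({k}, Y) \<in> E\<close> has \<open>card Y \<noteq> 1\<close>. The second bound
  is needed because a pattern \<open>({k}, {l})\<close> serves both as a row and as a column test; it shows
  that saving tests in this way does not pay off.
\<close>

lemma thin_row_count:
  assumes n: "n \<ge> 3" and E: "E \<subseteq> patterns n"
    and cov: "\<And>j k k'. j < n \<Longrightarrow> k < n \<Longrightarrow> k' < n \<Longrightarrow> k \<noteq> k' \<Longrightarrow> hits n j k E \<or> hits n j k' E"
  shows "\<exists>t. n \<le> card {p \<in> E. card (fst p) = 1 \<and> card (snd p) \<noteq> 1} + t \<and>
    n * (t - 1) \<le> card {p \<in> E. card (fst p) = 1}"
proof -
  define K where "K = {k. k < n \<and> (\<forall>Y. ({k}, Y) \<in> E \<longrightarrow> card Y = 1)}"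
  let ?R = "{p \<in> E. card (fst p) = 1 \<and> card (snd p) \<noteq> 1}" and ?A = "{p \<in> E. card (fst p) = 1}"
  have finE: "finite E" using E finite_patterns finite_subset by blast
  have finK: "finite K" by (simp add: K_def)
  have KN: "K \<subseteq> {..<n}" by (auto simp: K_def)
  have "{..<n} - K \<subseteq> (\<lambda>p. the_elem (fst p)) ` ?R"
  proof
    fix k assume "k \<in> {..<n} - K"
    then obtain Y where "({k}, Y) \<in> E" "card Y \<noteq> 1" by (auto simp: K_def)
    then have "({k}, Y) \<in> ?R" by simp
    moreover have "k = the_elem (fst ({k}, Y))" by simp
    ultimately show "k \<in> (\<lambda>p. the_elem (fst p)) ` ?R" by (rule rev_image_eqI)
  qed
  then have "card ({..<n} - K) \<le> card ?R" using finE by (intro surj_card_le) auto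
  then have 1: "n \<le> card ?R + card K" using KN finK by (simp add: card_Diff_subset)
  \<comment> \<open>By \<open>cov\<close>, each \<open>j\<close> leaves at most one \<open>k\<close>
    in \<open>K\<close> without a hit, so each of the \<open>n\<close> fibres has at least
    \<open>card K - 1\<close> elements.\<close>
  let ?Z = "SIGMA j:{..<n}. {k \<in> K. hits n j k E}"
  have "card K - 1 \<le> card {k \<in> K. hits n j k E}" if j: "j < n" for j
  proof -
    have "\<forall>a\<in>K - {k \<in> K. hits n j k E}. \<forall>b\<in>K - {k \<in> K. hits n j k E}. a = b"
      using cov[OF j] KN by blast
    then have "card (K - {k \<in> K. hits n j k E}) \<le> Suc 0"
      using finK by (subst card_le_Suc0_iff_eq) auto
    moreover have "card K = card {k \<in> K. hits n j k E} + card (K - {k \<in> K. hits n j k E})"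
      using finK by (subst card_Diff_subset) (auto intro: card_mono le_add_diff_inverse[symmetric])
    ultimately show ?thesis by linarith
  qed
  then have "(\<Sum>j<n. card K - 1) \<le> (\<Sum>j<n. card {k \<in> K. hits n j k E})"
    by (intro sum_mono) auto
  then have "n * (card K - 1) \<le> card ?Z" using finK by (subst card_SigmaI) auto
  also have "card ?Z \<le> card ?A"
  proof (rule card_inj_on_le)
    \<comment> \<open>Each hit is charged to a member of \<open>E\<close> with a single row. For
      \<open>k \<in> K\<close> a hit by \<open>({k}, Y)\<close> forces \<open>Y = {j}\<close>. Since
      \<open>n \<ge> 3\<close>, the set \<open>{..<n} - {k}\<close> is no singleton, so the two
      kinds of values cannot collide.\<close>
    let ?g = "\<lambda>(j, k). if ({k}, {j}) \<in> E then ({k}, {j}) else ({j}, {..<n} - {k})"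
    have two: "{..<n} - {k} \<noteq> {j}" for k j
    proof
      assume "{..<n} - {k} = {j}"
      then have "card ({..<n} - {k}) = 1" by simp
      then show False using n by (cases "k < n") (auto simp: card_Diff_singleton_if)
    qed
    have diff: "k = k'" if "k < n" "k' < n" "{..<n} - {k} = {..<n} - {k'}" for k k' using that by blast
    show "inj_on ?g ?Z"
    proof (rule inj_onI)
      fix x y assume x: "x \<in> ?Z" and y: "y \<in> ?Z" and eq: "?g x = ?g y"
      obtain j k j' k' where e: "x = (j, k)" "y = (j', k')" by fastforce
      have lt: "k < n" "k' < n" using x y KN by (auto simp: e)
      show "x = y" using eq two[of k j'] two[of k' j] two[of k' j, symmetric] diff[OF lt]
        by (auto simp: e split: if_splits)
    qed
    show "?g ` ?Z \<subseteq> ?A"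
    proof (rule image_subsetI)
      fix x assume x: "x \<in> ?Z"
      obtain j k where e: "x = (j, k)" by fastforce
      have "k \<in> K" "hits n j k E" using x by (auto simp: e)
      then have "({k}, {j}) \<in> E \<or> ({j}, {..<n} - {k}) \<in> E"
        by (auto simp: hits_def K_def card_1_singleton_iff)
      then show "?g x \<in> ?A" by (auto simp: e)
    qed
    show "finite ?A" using finE by simp
  qed
  finally show ?thesis using 1 by blast
qed

text \<open>The family \<open>patterns n - Q\<close> collects what the omission loses. By
  \<open>thin\<close>, a test with a single row lies outside \<open>Q\<close>, so a test that
  separates the two critical patterns is itself such a loss.\<close>

lemma hits_if_separates:
  assumes n: "n \<ge> 3" and P: "P \<subseteq> patterns n" and PQ: "patterns n \<subseteq> P \<union> Q"
    and sep: "separates n P Q"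
    and thin: "\<And>p. p \<in> P \<Longrightarrow> card (fst p) = 1 \<Longrightarrow> p \<notin> Q"
    and jk: "j < n" "k < n" "k' < n" "k \<noteq> k'"
  shows "hits n j k (patterns n - Q) \<or> hits n j k' (patterns n - Q)"
proof (rule ccontr)
  let ?N = "{..<n}"
  assume neg: "\<not> ?thesis"
  have Nj: "?N \<noteq> {j}" using n by (intro lessThan_neq_singleton) simp
  have pat: "({j}, ?N - {i}) \<in> patterns n" if "i < n" for i
  proof -
    have "?N - {i} \<noteq> {}" using n lessThan_neq_singleton[of n i] that by auto
    then show ?thesis using jk Nj by (auto simp: patterns_def)
  qed
  have "({j}, ?N - {k}) \<in> Q" "({j}, ?N - {k'}) \<in> Q"
    using neg pat jk by (auto simp: hits_def)
  moreover have "({j}, ?N - {k}) \<noteq> ({j}, ?N - {k'})" using jk by blast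
  ultimately obtain t where t: "t \<in> P"
    "pattern_dist n ({j}, ?N - {k}) t \<noteq> pattern_dist n ({j}, ?N - {k'}) t"
    by (rule separatesD[OF sep])
  obtain X Y where XY: "t = (X, Y)" by fastforce
  have X: "X \<subseteq> ?N" "X \<noteq> {}" and XYN: "X \<noteq> ?N \<or> Y \<noteq> ?N"
    using t P by (auto simp: XY patterns_def)
  have co: "?N - {k} \<noteq> ?N" "?N - {k'} \<noteq> ?N" using jk by blast+
  \<comment> \<open>Row and column sets of the two patterns are proper, so distance 3 would require
    \<open>X\<close> and \<open>Y\<close> both to be full. The test thus distinguishes by adjacency
    alone: \<open>j \<notin> Y\<close> would make it adjacent to both patterns, and otherwise it
    must avoid one of the two column sets.\<close>
  have "j \<in> Y" and "(?N - {k}) \<inter> X = {} \<or> (?N - {k'}) \<inter> X = {}"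
    using t(2) XYN Nj co by (auto simp: XY split: if_splits)
  then have "X = {k} \<or> X = {k'}" using X by blast
  moreover have "(X, Y) \<in> patterns n - Q" if "X = {i}" for i
    using thin[OF t(1)] t(1) P that by (auto simp: XY)
  ultimately show False using neg \<open>j \<in> Y\<close> by (auto simp: hits_def)
qed

lemma separates_swap:
  assumes "separates n P Q"
  shows "separates n (prod.swap ` P) (prod.swap ` Q)"
  unfolding separates_def
proof (intro ballI impI)
  fix p q assume "p \<in> prod.swap ` Q" "q \<in> prod.swap ` Q" "p \<noteq> q"
  then obtain p' q' where pq: "p' \<in> Q" "q' \<in> Q" "p' \<noteq> q'" "p = prod.swap p'" "q = prod.swap q'"
    by blast
  from separatesD[OF assms pq(1-3)] obtain t where
    "t \<in> P" "pattern_dist n p' t \<noteq> pattern_dist n q' t" .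
  then show "\<exists>t \<in> prod.swap ` P. pattern_dist n p t \<noteq> pattern_dist n q t"
    using pq(4,5) by (intro bexI[of _ "prod.swap t"]) auto
qed

lemma swap_image_patterns: "prod.swap ` patterns n = patterns n"
proof (intro equalityI subsetI)
  fix p assume "p \<in> prod.swap ` patterns n"
  then obtain q where "q \<in> patterns n" "p = prod.swap q" by (rule imageE)
  then show "p \<in> patterns n" by (simp only: swap_patterns_iff)
next
  fix p assume "p \<in> patterns n"
  then have "prod.swap p \<in> patterns n" by (simp only: swap_patterns_iff)
  then have "prod.swap (prod.swap p) \<in> prod.swap ` patterns n" by (rule imageI)
  then show "p \<in> prod.swap ` patterns n" by (simp only: swap_swap)
qed

lemma card_Collect_swap:
  "card {p \<in> prod.swap ` E. \<phi> (snd p) (fst p)} = card {p \<in> E. \<phi> (fst p) (snd p)}"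
proof -
  have "{p \<in> prod.swap ` E. \<phi> (snd p) (fst p)} = prod.swap ` {p \<in> E. \<phi> (fst p) (snd p)}" by auto
  then show ?thesis by (simp add: card_image)
qed

text \<open>For \<open>n \<ge> 3\<close>, \<open>thin_row_count\<close> is applied to rows and,
  through \<open>prod.swap\<close>, to columns, with witnesses \<open>t\<close> and
  \<open>u\<close>. If both are at most 1, \<open>?r\<close> and \<open>?c\<close> already sum to
  \<open>2 * (n - 1)\<close>. If \<open>t = 2\<close> and \<open>u \<le> 2\<close>, then
  \<open>?rs \<ge> n\<close> and \<open>?c \<ge> n - 2\<close>; if \<open>t \<ge> 3\<close>, then
  \<open>?rs \<ge> 2 * n\<close>. The roles of \<open>t\<close> and \<open>u\<close> are symmetric.
  For \<open>n = 2\<close> every pattern has a single row or column, and it remains to see that one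
  test is not enough.\<close>

lemma separates_lower_bound:
  assumes n: "n \<ge> 2" and P: "P \<subseteq> patterns n" and PQ: "patterns n \<subseteq> P \<union> Q"
    and sep: "separates n P Q"
    and thin: "\<And>p. p \<in> P \<Longrightarrow> card (fst p) = 1 \<or> card (snd p) = 1 \<Longrightarrow> p \<notin> Q"
  shows "2 * (n - 1) \<le> card (patterns n - Q)"
proof (cases "n = 2")
  case False
  with n have n3: "n \<ge> 3" by simp
  let ?E = "patterns n - Q"
  let ?r = "card {p \<in> ?E. card (fst p) = 1 \<and> card (snd p) \<noteq> 1}"
    and ?c = "card {p \<in> ?E. card (snd p) = 1 \<and> card (fst p) \<noteq> 1}"
    and ?rs = "card {p \<in> ?E. card (fst p) = 1}" and ?cs = "card {p \<in> ?E. card (snd p) = 1}"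
  obtain t where t: "n \<le> ?r + t" "n * (t - 1) \<le> ?rs"
    using thin_row_count[OF n3, of ?E] hits_if_separates[OF n3 P PQ sep] thin by auto
  have E': "patterns n - prod.swap ` Q = prod.swap ` ?E"
    by (simp add: image_set_diff swap_image_patterns)
  have "prod.swap ` P \<subseteq> patterns n" "patterns n \<subseteq> prod.swap ` P \<union> prod.swap ` Q"
    using P PQ by (metis image_mono swap_image_patterns, metis image_Un image_mono swap_image_patterns)
  note hits' = hits_if_separates[OF n3 this separates_swap[OF sep], unfolded E']
  have "prod.swap ` ?E \<subseteq> patterns n" using E' by blast
  moreover have "p \<notin> prod.swap ` Q" if "p \<in> prod.swap ` P" "card (fst p) = 1" for p
    using thin that by auto
  ultimately obtain u where "n \<le> card {p \<in> prod.swap ` ?E. card (fst p) = 1 \<and> card (snd p) \<noteq> 1} + u"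
    "n * (u - 1) \<le> card {p \<in> prod.swap ` ?E. card (fst p) = 1}"
    using thin_row_count[OF n3, of "prod.swap ` ?E"] hits' by auto
  then have u: "n \<le> ?c + u" "n * (u - 1) \<le> ?cs"
    using card_Collect_swap[where E = ?E and \<phi> = "\<lambda>R C. card C = 1 \<and> card R \<noteq> 1"]
      card_Collect_swap[where E = ?E and \<phi> = "\<lambda>R C. card C = 1"] by simp_all
  have fin: "finite ?E" using finite_patterns by simp
  have disj: "card {p \<in> ?E. \<phi> p} + card {p \<in> ?E. \<psi> p} \<le> card ?E" if "\<And>p. \<phi> p \<Longrightarrow> \<not> \<psi> p" for \<phi> \<psi>
  proof -
    have "card {p \<in> ?E. \<phi> p} + card {p \<in> ?E. \<psi> p} = card ({p \<in> ?E. \<phi> p} \<union> {p \<in> ?E. \<psi> p})"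
      using fin that by (intro card_Un_disjoint[symmetric]) (auto intro: rev_finite_subset)
    also have "\<dots> \<le> card ?E" using fin by (intro card_mono) auto
    finally show ?thesis .
  qed
  \<comment> \<open>A pattern \<open>({k}, {l})\<close> is counted in both \<open>?rs\<close> and
    \<open>?cs\<close>, so these two are never added; each sum here combines disjoint
    families.\<close>
  have rc: "?rs + ?c \<le> card ?E" "?cs + ?r \<le> card ?E" "?r + ?c \<le> card ?E"
    by (intro disj; simp)+
  have big: "2 * n \<le> n * (x - 1)" if "x \<ge> 3" for x :: nat
  proof -
    have "2 \<le> x - 1" using that by simp
    then show ?thesis by (metis mult_le_mono2 mult.commute)
  qed
  show ?thesis
  proof (cases "t \<ge> 3 \<or> u \<ge> 3")
    case True
    then show ?thesis using big[of t] big[of u] t u rc by linarith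
  next
    case False
    then show ?thesis
    proof (cases "t = 2")
      case True
      then have "n \<le> ?rs" using t by simp
      then show ?thesis using u rc False by linarith
    next
      case t2: False
      show ?thesis
      proof (cases "u = 2")
        case True
        then have "n \<le> ?cs" using u by simp
        then show ?thesis using t rc False by linarith
      next
        case False
        then show ?thesis using t2 \<open>\<not> (t \<ge> 3 \<or> u \<ge> 3)\<close> t u rc by linarith
      qed
    qed
  qed
next
  case n2: True
  have N: "{..<n} = {0, 1}" using n2 by auto
  have one: "card (fst p) = 1 \<or> card (snd p) = 1" if "p \<in> patterns n" for p
  proof -
    have full: "A = {..<n}" if "A \<subseteq> {..<n}" "A \<noteq> {}" "card A \<noteq> 1" for A
    proof (rule card_subset_eq)
      have "card A \<le> 2" using card_mono[OF _ that(1)] n2 by simp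
      moreover have "card A \<noteq> 0" using that(1,2) finite_subset[OF that(1)] by simp
      ultimately show "card A = card {..<n}" using that(3) n2 by simp
    qed (use that in auto)
    have "fst p \<subseteq> {..<n}" "snd p \<subseteq> {..<n}" "fst p \<noteq> {}" "snd p \<noteq> {}"
      and "\<not> (fst p = {..<n} \<and> snd p = {..<n})"
      using that by (auto simp: patterns_def)
    then show ?thesis using full by metis
  qed
  then have Q: "patterns n - Q = P" using P PQ thin by blast
  show ?thesis
  proof (rule ccontr)
    assume "\<not> ?thesis"
    then have "card P \<le> Suc 0" using n2 Q by simp
    moreover have finP: "finite P" using P finite_patterns finite_subset by blast
    ultimately have P1: "\<And>s t. s \<in> P \<Longrightarrow> t \<in> P \<Longrightarrow> s = t"
      using card_le_Suc0_iff_eq by blast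
    \<comment> \<open>An empty \<open>P\<close> is included: any pattern may then play the part of
      the only test.\<close>
    obtain X Y where XY: "P \<subseteq> {(X, Y)}" "(X, Y) \<in> patterns n"
    proof (cases "P = {}")
      case True
      have "({0}, {0}) \<in> patterns n" by (auto simp: patterns_def N)
      then show thesis using True that by blast
    next
      case False
      then obtain t where "t \<in> P" by blast
      then have "P \<subseteq> {(fst t, snd t)}" "(fst t, snd t) \<in> patterns n"
        unfolding prod.collapse using P1 P by blast+
      then show thesis by (rule that)
    qed
    \<comment> \<open>At most one of three patterns at distance 1 from the test is the test itself;
      the other two lie in \<open>Q\<close> and are not separated.\<close>
    have no_triple: False if pat: "a \<in> patterns n" "b \<in> patterns n" "c \<in> patterns n"
      and ne: "a \<noteq> b" "b \<noteq> c" "a \<noteq> c"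
      and dist: "\<And>p. p \<in> {a, b, c} \<Longrightarrow> pattern_dist n p (X, Y) = 1" for a b c
    proof -
      have Q: "p \<in> Q" if "p \<in> patterns n" "p \<noteq> (X, Y)" for p using that XY(1) PQ by blast
      have pair: False if "p \<in> Q" "q \<in> Q" "p \<noteq> q" "p \<in> {a, b, c}" "q \<in> {a, b, c}" for p q
      proof -
        from that(1-3) obtain t where "t \<in> P" "pattern_dist n p t \<noteq> pattern_dist n q t"
          by (rule separatesD[OF sep])
        then show False using XY(1) dist[OF that(4)] dist[OF that(5)] by auto
      qed
      consider "a = (X, Y)" | "b = (X, Y)" | "a \<noteq> (X, Y)" "b \<noteq> (X, Y)" by blast
      then show False
      proof cases
        case 1
        then show False using pair[of b c] Q[OF pat(2)] Q[OF pat(3)] ne by simp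
      next
        case 2
        then show False using pair[of a c] Q[OF pat(1)] Q[OF pat(3)] ne by simp
      next
        case 3
        then show False using pair[of a b] Q[OF pat(1)] Q[OF pat(2)] ne by simp
      qed
    qed
    have sub: "X \<subseteq> {0, 1}" "Y \<subseteq> {0, 1}" "X \<noteq> {}" "Y \<noteq> {}" "X \<noteq> {0, 1} \<or> Y \<noteq> {0, 1}"
      using XY(2) by (auto simp: patterns_def N)
    have "A = {0} \<or> A = {1}" if "A \<subseteq> {0, 1}" "A \<noteq> {}" "A \<noteq> {0, 1}" for A :: "nat set"
    proof (cases "0 \<in> A")
      case True
      then have "1 \<notin> A" using that by blast
      then show ?thesis using True that by blast
    next
      case False
      then show ?thesis using that by blast
    qed
    then consider "X = {0}" | "X = {1}" | "Y = {0}" | "Y = {1}" using sub by meson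
    then show False
    proof cases
      case 1
      show False by (rule no_triple[of "({0}, {1})" "({1}, {1})" "({0, 1}, {1})"])
          (auto simp: patterns_def N 1)
    next
      case 2
      show False by (rule no_triple[of "({0}, {0})" "({1}, {0})" "({0, 1}, {0})"])
          (auto simp: patterns_def N 2)
    next
      case 3
      show False by (rule no_triple[of "({1}, {0})" "({1}, {1})" "({1}, {0, 1})"])
          (auto simp: patterns_def N 3)
    next
      case 4
      show False by (rule no_triple[of "({0}, {0})" "({0}, {1})" "({0}, {0, 1})"])
          (auto simp: patterns_def N 4)
    qed
  qed
qed

section \<open>Distances in the zero-divisor graph\<close>

definition pattern_adj :: "nat set \<times> nat set \<Rightarrow> nat set \<times> nat set \<Rightarrow> bool" where
  "pattern_adj p q \<longleftrightarrow> snd p \<inter> fst q = {} \<or> fst p \<inter> snd q = {}"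

lemma pattern_dist_adj: "pattern_adj p q \<Longrightarrow> pattern_dist n p q = 1"
  by (cases p; cases q) (auto simp: pattern_adj_def)

lemma patternsI:
  assumes "P \<subseteq> {..<n}" "Q \<subseteq> {..<n}" "P \<noteq> {}" "Q \<noteq> {}" "P \<noteq> {..<n} \<or> Q \<noteq> {..<n}"
  shows "(P, Q) \<in> patterns n"
  using assms by (simp add: patterns_def)

text \<open>A common neighbour \<open>(P, Q)\<close> is joined to each of the two patterns through
  \<open>P\<close> or through \<open>Q\<close>. The four combinations give the four disjuncts in
  \<open>pattern_dist\<close>, and complements provide the witnesses.\<close>

lemma pattern_dist_not_adj:
  assumes "p \<in> patterns n" "q \<in> patterns n" "\<not> pattern_adj p q"
  shows "pattern_dist n p q = (if \<exists>r \<in> patterns n. pattern_adj p r \<and> pattern_adj r q then 2 else 3)"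
proof -
  let ?N = "{..<n}"
  obtain R C X Y where e: "p = (R, C)" "q = (X, Y)" by fastforce
  have sub: "R \<subseteq> ?N" "C \<subseteq> ?N" "X \<subseteq> ?N" "Y \<subseteq> ?N" "R \<noteq> {}" "C \<noteq> {}" "X \<noteq> {}" "Y \<noteq> {}"
    using assms(1,2) by (auto simp: patterns_def e)
  have "(\<exists>r \<in> patterns n. pattern_adj p r \<and> pattern_adj r q) \<longleftrightarrow>
    C \<noteq> ?N \<and> X \<noteq> ?N \<or> R \<noteq> ?N \<and> Y \<noteq> ?N \<or> C \<union> Y \<noteq> ?N \<or> R \<union> X \<noteq> ?N" (is "_ \<longleftrightarrow> ?D")
  proof
    assume "\<exists>r \<in> patterns n. pattern_adj p r \<and> pattern_adj r q"
    then obtain P Q where "(P, Q) \<in> patterns n" "C \<inter> P = {} \<or> R \<inter> Q = {}" "Q \<inter> X = {} \<or> P \<inter> Y = {}"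
      by (auto simp: e pattern_adj_def)
    moreover from this(1) have "P \<subseteq> ?N" "Q \<subseteq> ?N" "P \<noteq> {}" "Q \<noteq> {}" by (auto simp: patterns_def)
    moreover have ne: "A \<noteq> ?N" if "A \<inter> B = {}" "B \<subseteq> ?N" "B \<noteq> {}" for A B
      using that by blast
    moreover have "(C \<union> Y) \<inter> P = {}" if "C \<inter> P = {}" "P \<inter> Y = {}" using that by blast
    moreover have "(R \<union> X) \<inter> Q = {}" if "R \<inter> Q = {}" "Q \<inter> X = {}" using that by blast
    moreover have "X \<inter> Q = Q \<inter> X" "Y \<inter> P = P \<inter> Y" by blast+
    ultimately show ?D by metis
  next
    assume ?D
    have co: "?N - A \<noteq> {}" if "A \<noteq> ?N" "A \<subseteq> ?N" for A using that by auto
    have co': "?N - A \<noteq> ?N" if "A \<noteq> {}" "A \<subseteq> ?N" for A using that by auto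
    from \<open>?D\<close> consider "C \<noteq> ?N" "X \<noteq> ?N" | "R \<noteq> ?N" "Y \<noteq> ?N" | "C \<union> Y \<noteq> ?N" | "R \<union> X \<noteq> ?N" by meson
    then show "\<exists>r \<in> patterns n. pattern_adj p r \<and> pattern_adj r q"
    proof cases
      case 1
      then have "(?N - C, ?N - X) \<in> patterns n" using sub by (intro patternsI co disjI1 co') auto
      then show ?thesis by (rule bexI[rotated]) (auto simp: pattern_adj_def e)
    next
      case 2
      then have "(?N - Y, ?N - R) \<in> patterns n" using sub by (intro patternsI co disjI1 co') auto
      then show ?thesis by (rule bexI[rotated]) (auto simp: pattern_adj_def e)
    next
      case 3
      then have "(?N - (C \<union> Y), ?N) \<in> patterns n" using sub by (intro patternsI co disjI1 co') auto
      then show ?thesis by (rule bexI[rotated]) (auto simp: pattern_adj_def e)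
    next
      case 4
      then have "(?N, ?N - (R \<union> X)) \<in> patterns n" using sub by (intro patternsI co disjI2 co') auto
      then show ?thesis by (rule bexI[rotated]) (auto simp: pattern_adj_def e)
    qed
  qed
  then show ?thesis using assms(3) by (simp add: e pattern_adj_def)
qed

text \<open>Without a common neighbour, \<open>C\<close> or \<open>X\<close> is full, and
  \<open>R\<close> or \<open>Y\<close> is full. As neither pattern is full on both sides, either
  \<open>R\<close> and \<open>X\<close> or \<open>C\<close> and \<open>Y\<close> are proper, and
  their complements provide the two inner patterns. This bounds the diameter by 3.\<close>

lemma pattern_path_3:
  assumes p: "p \<in> patterns n" and q: "q \<in> patterns n" and "\<not> pattern_adj p q"
    and no: "\<not> (\<exists>r \<in> patterns n. pattern_adj p r \<and> pattern_adj r q)"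
  shows "\<exists>r \<in> patterns n. \<exists>s \<in> patterns n. pattern_adj p r \<and> pattern_adj r s \<and> pattern_adj s q"
proof -
  let ?N = "{..<n}"
  obtain R C X Y where e: "p = (R, C)" "q = (X, Y)" by fastforce
  have sub: "R \<subseteq> ?N" "C \<subseteq> ?N" "X \<subseteq> ?N" "Y \<subseteq> ?N" "R \<noteq> {}" "C \<noteq> {}" "X \<noteq> {}" "Y \<noteq> {}"
    "R \<noteq> ?N \<or> C \<noteq> ?N" "X \<noteq> ?N \<or> Y \<noteq> ?N"
    using p q by (auto simp: patterns_def e)
  have "pattern_dist n p q \<noteq> 2" using pattern_dist_not_adj[OF assms(1-3)] no by simp
  then have "\<not> (C \<noteq> ?N \<and> X \<noteq> ?N) \<and> \<not> (R \<noteq> ?N \<and> Y \<noteq> ?N)"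
    using assms(3) by (simp add: e pattern_adj_def split: if_splits)
  then have "R \<noteq> ?N \<and> X \<noteq> ?N \<or> C \<noteq> ?N \<and> Y \<noteq> ?N" using sub(9,10) by argo
  then show ?thesis
  proof
    assume 1: "R \<noteq> ?N \<and> X \<noteq> ?N"
    have "?N - R \<noteq> {}" "?N - X \<noteq> {}" "?N - R \<noteq> ?N" "?N \<noteq> {}" using 1 sub by auto
    then have r: "(?N, ?N - R) \<in> patterns n" and s: "(R, ?N - X) \<in> patterns n"
      using sub 1 by (simp_all add: patterns_def)
    have "pattern_adj p (?N, ?N - R)" "pattern_adj (?N, ?N - R) (R, ?N - X)" "pattern_adj (R, ?N - X) q"
      by (auto simp: pattern_adj_def e)
    with r s show ?thesis by blast
  next
    assume 2: "C \<noteq> ?N \<and> Y \<noteq> ?N"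
    have "?N - C \<noteq> {}" "?N - Y \<noteq> {}" "?N - C \<noteq> ?N" "?N \<noteq> {}" using 2 sub by auto
    then have r: "(?N - C, ?N) \<in> patterns n" and s: "(?N - Y, C) \<in> patterns n"
      using sub 2 by (simp_all add: patterns_def)
    have "pattern_adj p (?N - C, ?N)" "pattern_adj (?N - C, ?N) (?N - Y, C)" "pattern_adj (?N - Y, C) q"
      by (auto simp: pattern_adj_def e)
    with r s show ?thesis by blast
  qed
qed

lemma graph_dist_eqI:
  assumes "wf_digraph G" "pre_digraph.awalk G u p v"
    and "\<And>q. pre_digraph.awalk G u q v \<Longrightarrow> length p \<le> length q"
  shows "graph_dist G u v = ereal (real (length p))"
  unfolding graph_dist_eq[OF assms(1)]
  by (rule antisym) (auto intro!: INF_lower2[of p] INF_greatest assms)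

lemma graph_dist_with_proj:
  fixes G :: "'v pair_pre_digraph"
  assumes "pair_wf_digraph G" and u: "u \<in> pverts G"
  shows "graph_dist G u u = ereal (real 0)"
    and "(u, v) \<in> parcs G \<Longrightarrow> u \<noteq> v \<Longrightarrow> graph_dist G u v = ereal (real 1)"
    and "(u, x) \<in> parcs G \<Longrightarrow> (x, v) \<in> parcs G \<Longrightarrow> u \<noteq> v \<Longrightarrow> (u, v) \<notin> parcs G \<Longrightarrow>
      graph_dist G u v = ereal (real 2)"
    and "(u, x) \<in> parcs G \<Longrightarrow> (x, y) \<in> parcs G \<Longrightarrow> (y, v) \<in> parcs G \<Longrightarrow> u \<noteq> v \<Longrightarrow>
      (u, v) \<notin> parcs G \<Longrightarrow> (\<And>z. (u, z) \<in> parcs G \<Longrightarrow> (z, v) \<notin> parcs G) \<Longrightarrow>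
      graph_dist G u v = ereal (real 3)"
proof -
  interpret pair_wf_digraph G by fact
  have walk: "pre_digraph.awalk G a p b \<longleftrightarrow> a \<in> pverts G \<and> set p \<subseteq> parcs G \<and> pcas a p b" for a p b
    by (simp add: pre_digraph.awalk_def)
  note eqI = graph_dist_eqI[OF wf_digraph_axioms, unfolded walk]
  show "graph_dist G u u = ereal (real 0)"
    using eqI[of u "[]" u] u by simp
  have long1: "Suc 0 \<le> length q" if "pcas u q v" "u \<noteq> v" for q v
    using that by (cases q) auto
  have long2: "Suc (Suc 0) \<le> length q" if "pcas u q v" "set q \<subseteq> parcs G" "u \<noteq> v" "(u, v) \<notin> parcs G" for q v
    using that by (cases q; cases "tl q") (auto simp: neq_Nil_conv)
  have long3: "Suc (Suc (Suc 0)) \<le> length q"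
    if q: "pcas u q v" "set q \<subseteq> parcs G" "u \<noteq> v" "(u, v) \<notin> parcs G"
      and no: "\<And>z. (u, z) \<in> parcs G \<Longrightarrow> (z, v) \<notin> parcs G" for q v
  proof -
    have "length q \<noteq> 2"
    proof
      assume "length q = 2"
      then obtain a b where "q = [a, b]" by (auto simp: numeral_2_eq_2 length_Suc_conv)
      then show False using q no[of "snd a"] by (cases a; cases b) auto
    qed
    then show ?thesis using long2[OF q] by linarith
  qed
  show "graph_dist G u v = ereal (real 1)" if "(u, v) \<in> parcs G" "u \<noteq> v"
    using eqI[of u "[(u, v)]" v] u that long1[OF _ that(2)] by simp
  show "graph_dist G u v = ereal (real 2)"
    if "(u, x) \<in> parcs G" "(x, v) \<in> parcs G" "u \<noteq> v" "(u, v) \<notin> parcs G"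
    using eqI[of u "[(u, x), (x, v)]" v] u that long2[OF _ _ that(3,4)] by simp
  show "graph_dist G u v = ereal (real 3)"
    if "(u, x) \<in> parcs G" "(x, y) \<in> parcs G" "(y, v) \<in> parcs G" "u \<noteq> v"
      "(u, v) \<notin> parcs G" "\<And>z. (u, z) \<in> parcs G \<Longrightarrow> (z, v) \<notin> parcs G"
    using eqI[of u "[(u, x), (x, y), (y, v)]" v] u that long3[OF _ _ that(4,5,6)] by simp
qed

section \<open>Supports of matrices and vanishing products\<close>

definition support_pattern :: "nat \<Rightarrow> 'a::zero mat \<Rightarrow> nat set \<times> nat set" where
  "support_pattern n A = ({i. i < n \<and> (\<exists>j<n. A $$ (i, j) \<noteq> 0)}, {j. j < n \<and> (\<exists>i<n. A $$ (i, j) \<noteq> 0)})"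

text \<open>A standard carrier of the pattern \<open>p\<close>. The parameter \<open>a\<close>
  supplies a second carrier as soon as there is a nonzero element other than 1.\<close>

definition block_mat :: "nat \<Rightarrow> 'a::zero \<Rightarrow> nat set \<times> nat set \<Rightarrow> 'a mat" where
  "block_mat n a p = mat n n (\<lambda>(i, j). if i \<in> fst p \<and> j \<in> snd p then a else 0)"

lemma block_mat_carrier [simp]: "block_mat n a p \<in> carrier_mat n n"
  by (simp add: block_mat_def)

lemma support_pattern_block_mat:
  assumes "p \<in> patterns n" "a \<noteq> 0"
  shows "support_pattern n (block_mat n a p) = p"
proof (cases p)
  case (Pair R C)
  have sub: "R \<subseteq> {..<n}" "C \<subseteq> {..<n}" "R \<noteq> {}" "C \<noteq> {}"
    using assms(1) by (auto simp: patterns_def Pair)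
  then obtain r c where rc: "r \<in> R" "c \<in> C" "r < n" "c < n" by blast
  have entry: "block_mat n a p $$ (i, j) \<noteq> 0 \<longleftrightarrow> i \<in> R \<and> j \<in> C" if "i < n" "j < n" for i j
    using that assms(2) by (simp add: block_mat_def Pair)
  have "{i. i < n \<and> (\<exists>j<n. block_mat n a p $$ (i, j) \<noteq> 0)} = R"
    using entry rc sub by (simp cong: conj_cong) blast
  moreover have "{j. j < n \<and> (\<exists>i<n. block_mat n a p $$ (i, j) \<noteq> 0)} = C"
    using entry rc sub by (simp cong: conj_cong) blast
  ultimately show ?thesis by (simp add: support_pattern_def Pair)
qed

lemma sum_eq_0_iff_antinegative:
  fixes f :: "'b \<Rightarrow> 'a::semiring_1"
  assumes "antinegative TYPE('a)" "finite I"
  shows "sum f I = 0 \<longleftrightarrow> (\<forall>i \<in> I. f i = 0)"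
  using assms(2)
proof (induction I rule: finite_induct)
  case (insert i I)
  have "a + b = 0 \<longleftrightarrow> a = 0 \<and> b = 0" for a b :: 'a
    using assms(1) unfolding antinegative_def by (metis add_0)
  then show ?case using insert by simp
qed simp

lemma eq_0_mat_iff:
  assumes "A \<in> carrier_mat n n"
  shows "A = 0\<^sub>m n n \<longleftrightarrow> (\<forall>i<n. \<forall>j<n. A $$ (i, j) = 0)"
proof
  assume "\<forall>i<n. \<forall>j<n. A $$ (i, j) = 0"
  then show "A = 0\<^sub>m n n" using assms by (intro eq_matI) auto
qed simp

text \<open>Antinegativity rules out cancellation in the sums that form the entries, so every
  product \<open>A $$ (i, k) * B $$ (k, j)\<close> vanishes; as there are no zero divisors, one
  factor is 0. For fixed \<open>k\<close> and all \<open>i\<close>, \<open>j\<close> this says that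
  column \<open>k\<close> of \<open>A\<close> or row \<open>k\<close> of \<open>B\<close> is
  zero.\<close>

lemma mat_mult_eq_0_iff:
  fixes A B :: "'a::semiring_1_no_zero_divisors mat"
  assumes S: "antinegative TYPE('a)" and A: "A \<in> carrier_mat n n" and B: "B \<in> carrier_mat n n"
  shows "A * B = 0\<^sub>m n n \<longleftrightarrow> snd (support_pattern n A) \<inter> fst (support_pattern n B) = {}"
proof -
  have entry: "(A * B) $$ (i, j) = (\<Sum>k \<in> {0..<n}. A $$ (i, k) * B $$ (k, j))" if "i < n" "j < n" for i j
    using that A B by (simp add: scalar_prod_def)
  have "A * B = 0\<^sub>m n n \<longleftrightarrow> (\<forall>i<n. \<forall>j<n. (A * B) $$ (i, j) = 0)"
    by (rule eq_0_mat_iff) (use A B in simp)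
  also have "\<dots> \<longleftrightarrow> (\<forall>i<n. \<forall>j<n. \<forall>k<n. A $$ (i, k) = 0 \<or> B $$ (k, j) = 0)"
    using entry by (simp add: sum_eq_0_iff_antinegative[OF S] Ball_def)
  also have "\<dots> \<longleftrightarrow> snd (support_pattern n A) \<inter> fst (support_pattern n B) = {}"
    by (auto simp: support_pattern_def)
  finally show ?thesis .
qed

lemma support_pattern_eq_empty_iff:
  fixes A :: "'a::zero mat"
  assumes "A \<in> carrier_mat n n"
  shows "fst (support_pattern n A) = {} \<longleftrightarrow> A = 0\<^sub>m n n" "snd (support_pattern n A) = {} \<longleftrightarrow> A = 0\<^sub>m n n"
  unfolding eq_0_mat_iff[OF assms] by (auto simp: support_pattern_def)

lemma support_pattern_subset:
  "fst (support_pattern n A) \<subseteq> {..<n}" "snd (support_pattern n A) \<subseteq> {..<n}"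
  by (auto simp: support_pattern_def)

definition pattern_mats :: "'a::zero itself \<Rightarrow> nat \<Rightarrow> 'a mat set" where
  "pattern_mats _ n = {A \<in> carrier_mat n n. support_pattern n A \<in> patterns n}"

abbreviation (input) mat_graph :: "'a::semiring_1 itself \<Rightarrow> nat \<Rightarrow> 'a mat pair_pre_digraph" where
  "mat_graph S n \<equiv> zero_divisor_graph (ring_mat S n ())"

lemma pverts_mat_graph:
  assumes S: "antinegative TYPE('a::semiring_1_no_zero_divisors)"
  shows "pverts (mat_graph TYPE('a) n) = pattern_mats TYPE('a) n"
proof (rule Set.set_eqI)
  fix A :: "'a mat"
  let ?p = "support_pattern n A" and ?N = "{..<n}"
  have "(\<exists>B \<in> carrier_mat n n. B \<noteq> 0\<^sub>m n n \<and> (A * B = 0\<^sub>m n n \<or> B * A = 0\<^sub>m n n)) \<longleftrightarrow>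
      \<not> (fst ?p = ?N \<and> snd ?p = ?N)" (is "?L \<longleftrightarrow> ?R") if A: "A \<in> carrier_mat n n" "A \<noteq> 0\<^sub>m n n"
  proof
    assume ?L
    then obtain B where B: "B \<in> carrier_mat n n" "B \<noteq> 0\<^sub>m n n"
      "A * B = 0\<^sub>m n n \<or> B * A = 0\<^sub>m n n" by blast
    then have B': "snd ?p \<inter> fst (support_pattern n B) = {} \<or> snd (support_pattern n B) \<inter> fst ?p = {}"
      using mat_mult_eq_0_iff[OF S A(1) B(1)] mat_mult_eq_0_iff[OF S B(1) A(1)] by simp
    have "fst (support_pattern n B) \<noteq> {}" "snd (support_pattern n B) \<noteq> {}"
      using support_pattern_eq_empty_iff[OF B(1)] B(2) by simp_all
    then show ?R using B' support_pattern_subset[of n B] by blast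
  next
    assume ?R
    have ne: "fst ?p \<noteq> {}" "snd ?p \<noteq> {}" using support_pattern_eq_empty_iff[OF A(1)] A(2) by simp_all
    \<comment> \<open>If \<open>A\<close> has a zero column, a right annihilator lives in the rows
      with these indices; otherwise \<open>A\<close> has a zero row, and a left annihilator lives in
      the corresponding columns.\<close>
    define q where "q = (if snd ?p = ?N then (?N, ?N - fst ?p) else (?N - snd ?p, ?N))"
    have N: "?N \<noteq> {}" using ne support_pattern_subset[of n A] by blast
    have q: "q \<in> patterns n"
    proof (cases "snd ?p = ?N")
      case True
      then have "?N - fst ?p \<noteq> {}" using \<open>?R\<close> support_pattern_subset[of n A] by blast
      moreover have "?N - fst ?p \<noteq> ?N" using ne support_pattern_subset[of n A] by blast
      ultimately show ?thesis using True N by (simp add: q_def patterns_def)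
    next
      case False
      then have "?N - snd ?p \<noteq> {}" using support_pattern_subset[of n A] by blast
      moreover have "?N - snd ?p \<noteq> ?N" using ne support_pattern_subset[of n A] by blast
      ultimately show ?thesis using False N by (simp add: q_def patterns_def)
    qed
    let ?B = "block_mat n (1 :: 'a) q"
    have sB: "support_pattern n ?B = q" using q by (rule support_pattern_block_mat) simp
    have "?B \<noteq> 0\<^sub>m n n"
      using support_pattern_eq_empty_iff(1)[OF block_mat_carrier, of n "1::'a" q] q sB
      by (cases q) (simp add: patterns_def)
    moreover have "snd ?p \<inter> fst q = {} \<or> snd q \<inter> fst ?p = {}" by (auto simp: q_def)
    moreover have "A * ?B = 0\<^sub>m n n \<longleftrightarrow> snd ?p \<inter> fst q = {}" "?B * A = 0\<^sub>m n n \<longleftrightarrow> snd q \<inter> fst ?p = {}"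
      using mat_mult_eq_0_iff[OF S A(1) block_mat_carrier, of 1 q]
        mat_mult_eq_0_iff[OF S block_mat_carrier A(1), of 1 q] by (simp_all add: sB)
    ultimately show ?L using block_mat_carrier[of n "1::'a" q] by blast
  qed
  moreover have "?p \<in> patterns n \<longleftrightarrow> fst ?p \<noteq> {} \<and> snd ?p \<noteq> {} \<and> \<not> (fst ?p = ?N \<and> snd ?p = ?N)"
    using support_pattern_subset[of n A] by (cases ?p) (simp add: patterns_def)
  moreover have "A \<in> pverts (mat_graph TYPE('a) n) \<longleftrightarrow> A \<in> carrier_mat n n \<and> A \<noteq> 0\<^sub>m n n \<and>
      (\<exists>B \<in> carrier_mat n n. B \<noteq> 0\<^sub>m n n \<and> (A * B = 0\<^sub>m n n \<or> B * A = 0\<^sub>m n n))"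
    by (auto simp: zero_divisor_graph_def zero_divisors_def ring_mat_simps)
  ultimately show "A \<in> pverts (mat_graph TYPE('a) n) \<longleftrightarrow> A \<in> pattern_mats TYPE('a) n"
    using support_pattern_eq_empty_iff[of A n] unfolding pattern_mats_def by (simp, argo)
qed

lemma parcs_mat_graph:
  assumes S: "antinegative TYPE('a::semiring_1_no_zero_divisors)"
  shows "(A, B) \<in> parcs (mat_graph TYPE('a) n) \<longleftrightarrow>
    A \<in> pattern_mats TYPE('a) n \<and> B \<in> pattern_mats TYPE('a) n \<and> A \<noteq> B \<and>
    pattern_adj (support_pattern n A) (support_pattern n B)"
proof -
  have "(A, B) \<in> parcs (mat_graph TYPE('a) n) \<longleftrightarrow> A \<in> pattern_mats TYPE('a) n \<and>
    B \<in> pattern_mats TYPE('a) n \<and> A \<noteq> B \<and> (A * B = 0\<^sub>m n n \<or> B * A = 0\<^sub>m n n)"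
    unfolding pverts_mat_graph[OF S, symmetric] by (simp add: zero_divisor_graph_def ring_mat_simps)
  then show ?thesis
    using mat_mult_eq_0_iff[OF S, of A n B] mat_mult_eq_0_iff[OF S, of B n A]
    by (auto simp: pattern_mats_def pattern_adj_def)
qed

lemma ex_mat_with_pattern:
  assumes "p \<in> patterns n"
  obtains A :: "'a::zero_neq_one mat" where "A \<in> pattern_mats TYPE('a) n" "support_pattern n A = p"
  using that[of "block_mat n 1 p"] assms support_pattern_block_mat[OF assms, of "1::'a"]
  by (simp add: pattern_mats_def)

text \<open>Every pattern has a carrier, so walks between patterns lift to matrices. A pattern may
  be adjacent to itself while the graph has no loops, so consecutive lifted vertices must be shown
  to differ.\<close>

lemma graph_dist_mat_graph:
  assumes S: "antinegative TYPE('a::semiring_1_no_zero_divisors)"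
    and A: "A \<in> pattern_mats TYPE('a) n" and B: "B \<in> pattern_mats TYPE('a) n"
  shows "graph_dist (mat_graph TYPE('a) n) A B =
    ereal (real (if A = B then 0 else pattern_dist n (support_pattern n A) (support_pattern n B)))"
proof -
  let ?G = "mat_graph TYPE('a) n" and ?s = "support_pattern n"
  note arc = parcs_mat_graph[OF S]
  have wf: "pair_wf_digraph ?G"
    by standard (auto simp: pverts_mat_graph[OF S] arc)
  have Av: "A \<in> pverts ?G" using A by (simp add: pverts_mat_graph[OF S])
  note d = graph_dist_with_proj[OF wf Av]
  have pA: "?s A \<in> patterns n" and pB: "?s B \<in> patterns n" using A B by (auto simp: pattern_mats_def)
  have sym: "pattern_adj p q \<longleftrightarrow> pattern_adj q p" for p q by (auto simp: pattern_adj_def)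
  consider "A = B" | "A \<noteq> B" "pattern_adj (?s A) (?s B)"
    | r where "A \<noteq> B" "\<not> pattern_adj (?s A) (?s B)" "r \<in> patterns n" "pattern_adj (?s A) r" "pattern_adj r (?s B)"
    | "A \<noteq> B" "\<not> pattern_adj (?s A) (?s B)" "\<not> (\<exists>r \<in> patterns n. pattern_adj (?s A) r \<and> pattern_adj r (?s B))"
    by blast
  then show ?thesis
  proof cases
    case 1
    then show ?thesis using d(1) by simp
  next
    case 2
    then show ?thesis using d(2)[of B] A B by (simp add: arc pattern_dist_adj)
  next
    case (3 r)
    obtain C :: "'a mat" where C: "C \<in> pattern_mats TYPE('a) n" "?s C = r"
      using ex_mat_with_pattern[OF 3(3)] by blast
    have "C \<noteq> A" "C \<noteq> B" using 3 C by auto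
    then have "graph_dist ?G A B = ereal (real 2)"
      using 3 C A B by (intro d(3)[of C]) (auto simp: arc)
    moreover have "pattern_dist n (?s A) (?s B) = 2"
      using pattern_dist_not_adj[OF pA pB 3(2)] 3 by auto
    ultimately show ?thesis using 3(1) by simp
  next
    case 4
    obtain r s where rs: "r \<in> patterns n" "s \<in> patterns n" "pattern_adj (?s A) r" "pattern_adj r s" "pattern_adj s (?s B)"
      using pattern_path_3[OF pA pB 4(2,3)] by blast
    obtain C D :: "'a mat" where C: "C \<in> pattern_mats TYPE('a) n" "?s C = r"
      and D: "D \<in> pattern_mats TYPE('a) n" "?s D = s"
      using ex_mat_with_pattern[OF rs(1)] ex_mat_with_pattern[OF rs(2)] by metis
    \<comment> \<open>If two consecutive vertices coincided, \<open>r\<close> or \<open>s\<close>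
      would be a common neighbour of the two end patterns.\<close>
    have "C \<noteq> A" "C \<noteq> D" "D \<noteq> B" using 4 rs C D by auto
    then have "graph_dist ?G A B = ereal (real 3)"
      using 4 rs C D A B by (intro d(4)[of C D]) (auto simp: arc pattern_mats_def)
    moreover have "pattern_dist n (?s A) (?s B) = 3"
      using pattern_dist_not_adj[OF pA pB 4(2)] 4(3) by simp
    ultimately show ?thesis using 4(1) by simp
  qed
qed

section \<open>Counting vertices\<close>

lemma sum_Pow_card:
  fixes g :: "nat \<Rightarrow> int"
  assumes "finite A"
  shows "(\<Sum>U \<in> Pow A. g (card U)) = (\<Sum>k = 0..card A. int (card A choose k) * g k)"
proof -
  have "(\<Sum>U \<in> Pow A. g (card U)) = (\<Sum>k = 0..card A. \<Sum>U \<in> {U \<in> Pow A. card U = k}. g (card U))"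
    using assms by (intro sum.group[symmetric]) (auto intro: card_mono)
  also have "\<dots> = (\<Sum>k = 0..card A. int (card A choose k) * g k)"
  proof (rule sum.cong)
    fix k
    have "(\<Sum>U \<in> {U \<in> Pow A. card U = k}. g (card U)) = int (card {U. U \<subseteq> A \<and> card U = k}) * g k"
      by simp
    then show "(\<Sum>U \<in> {U \<in> Pow A. card U = k}. g (card U)) = int (card A choose k) * g k"
      by (simp only: n_subsets[OF assms])
  qed simp
  finally show ?thesis .
qed

lemma sum_Pow_alternating:
  assumes "finite A"
  shows "(\<Sum>U \<in> Pow A. (- 1) ^ card U) = (if A = {} then 1 else 0 :: int)"
proof (cases "A = {}")
  case False
  then have "card A > 0" using assms by (simp add: card_gt_0_iff)
  then have "(\<Sum>k \<le> card A. (- 1) ^ k * int (card A choose k)) = 0"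
    by (rule choose_alternating_sum)
  then show ?thesis
    using False sum_Pow_card[OF assms, of "\<lambda>k. (- 1) ^ k"]
    by (simp add: atLeast0AtMost mult.commute)
qed simp

text \<open>Rows are encoded as extensional functions, so that a condition on each row separately
  turns a set of matrices into a function space, which has \<open>card X ^ n\<close>
  elements.\<close>

lemma bij_betw_mat_PiE:
  "bij_betw (\<lambda>A. \<lambda>i\<in>{..<n}. \<lambda>j\<in>{..<n}. A $$ (i, j)) {A \<in> carrier_mat n n. \<forall>i<n. (\<lambda>j\<in>{..<n}. A $$ (i, j)) \<in> X}
     ({..<n} \<rightarrow>\<^sub>E X)"
  if "X \<subseteq> {..<n} \<rightarrow>\<^sub>E UNIV"
proof (rule bij_betw_byWitness[where f' = "\<lambda>f. mat n n (\<lambda>(i, j). f i j)"])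
  have row: "(\<lambda>j\<in>{..<n}. f i j) = f i" if "f \<in> {..<n} \<rightarrow>\<^sub>E X" "i < n" for f i
  proof -
    have "f i \<in> {..<n} \<rightarrow>\<^sub>E UNIV" using that \<open>X \<subseteq> _\<close> by auto
    then show ?thesis by (rule PiE_restrict[unfolded restrict_def[symmetric]])
  qed
  have rest: "(\<lambda>j\<in>{..<n}. mat n n (\<lambda>(i, j). f i j) $$ (i, j)) = f i" if "f \<in> {..<n} \<rightarrow>\<^sub>E X" "i < n" for f i
    using row[OF that] that(2) by (simp cong: restrict_cong)
  show "\<forall>f \<in> {..<n} \<rightarrow>\<^sub>E X. (\<lambda>i\<in>{..<n}. \<lambda>j\<in>{..<n}. mat n n (\<lambda>(i, j). f i j) $$ (i, j)) = f"
  proof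
    fix f assume f: "f \<in> {..<n} \<rightarrow>\<^sub>E X"
    show "(\<lambda>i\<in>{..<n}. \<lambda>j\<in>{..<n}. mat n n (\<lambda>(i, j). f i j) $$ (i, j)) = f"
    proof
      fix i show "(\<lambda>i\<in>{..<n}. \<lambda>j\<in>{..<n}. mat n n (\<lambda>(i, j). f i j) $$ (i, j)) i = f i"
        using rest[OF f, of i] PiE_arb[OF f, of i] by (cases "i < n") simp_all
    qed
  qed
  show "\<forall>A \<in> {A \<in> carrier_mat n n. \<forall>i<n. (\<lambda>j\<in>{..<n}. A $$ (i, j)) \<in> X}.
      mat n n (\<lambda>(i, j). (\<lambda>i\<in>{..<n}. \<lambda>j\<in>{..<n}. A $$ (i, j)) i j) = A"
    by (auto intro!: eq_matI)
  show "(\<lambda>A. \<lambda>i\<in>{..<n}. \<lambda>j\<in>{..<n}. A $$ (i, j)) ` {A \<in> carrier_mat n n. \<forall>i<n. (\<lambda>j\<in>{..<n}. A $$ (i, j)) \<in> X}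
      \<subseteq> {..<n} \<rightarrow>\<^sub>E X"
    by (auto intro!: restrict_PiE_iff[THEN iffD2])
  show "(\<lambda>f. mat n n (\<lambda>(i, j). f i j)) ` ({..<n} \<rightarrow>\<^sub>E X)
      \<subseteq> {A \<in> carrier_mat n n. \<forall>i<n. (\<lambda>j\<in>{..<n}. A $$ (i, j)) \<in> X}"
    using rest by (auto simp: PiE_mem)
qed

lemma card_mat_rows:
  assumes "X \<subseteq> {..<n} \<rightarrow>\<^sub>E UNIV"
  shows "card {A \<in> carrier_mat n n. \<forall>i<n. (\<lambda>j\<in>{..<n}. A $$ (i, j)) \<in> X} = card X ^ n"
  using bij_betw_same_card[OF bij_betw_mat_PiE[OF assms]] by (simp add: card_funcsetE)

lemma card_carrier_mat:
  "card (carrier_mat n n :: 'a::finite mat set) = CARD('a) ^ n\<^sup>2"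
proof -
  have "{A \<in> carrier_mat n n. \<forall>i<n. (\<lambda>j\<in>{..<n}. A $$ (i, j)) \<in> {..<n} \<rightarrow>\<^sub>E UNIV} = (carrier_mat n n :: 'a mat set)"
    by auto
  then show ?thesis
    using card_mat_rows[of "{..<n} \<rightarrow>\<^sub>E (UNIV :: 'a set)" n]
    by (simp add: card_funcsetE power_mult[symmetric] power2_eq_square)
qed

lemma finite_carrier_mat: "finite (carrier_mat n n :: 'a::finite mat set)"
  by (rule card_ge_0_finite) (simp add: card_carrier_mat)

text \<open>The rows are chosen independently: each is an arbitrary nonzero vector supported in
  \<open>T\<close>.\<close>

lemma card_mat_full_rows:
  assumes T: "T \<subseteq> {..<n}"
  shows "card {A :: 'a::{finite, zero} mat. A \<in> carrier_mat n n \<and> fst (support_pattern n A) = {..<n} \<and>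
      snd (support_pattern n A) \<subseteq> T} = (CARD('a) ^ card T - 1) ^ n"
proof -
  let ?Y = "\<lambda>j. if j \<in> T then UNIV else {0 :: 'a}"
  define X where "X = Pi\<^sub>E {..<n} ?Y - {\<lambda>j\<in>{..<n}. 0}"
  have "(\<Prod>j<n. card (?Y j)) = (\<Prod>j<n. if j \<in> T then CARD('a) else 1)" by (intro prod.cong) auto
  also have "\<dots> = (\<Prod>j \<in> {j \<in> {..<n}. j \<in> T}. CARD('a))" by (rule prod.inter_filter[symmetric]) simp
  also have "{j \<in> {..<n}. j \<in> T} = T" using T by blast
  also have "(\<Prod>j \<in> T. CARD('a)) = CARD('a) ^ card T" by simp
  finally have "card (Pi\<^sub>E {..<n} ?Y) = CARD('a) ^ card T" by (simp add: card_PiE)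
  moreover have "(\<lambda>j\<in>{..<n}. 0) \<in> Pi\<^sub>E {..<n} ?Y" by auto
  moreover have "finite (Pi\<^sub>E {..<n} ?Y)" by (intro finite_PiE) auto
  ultimately have cX: "card X = CARD('a) ^ card T - 1" by (simp add: X_def)
  have row: "(\<lambda>j\<in>{..<n}. A $$ (i, j)) \<in> X \<longleftrightarrow>
      (\<exists>j<n. A $$ (i, j) \<noteq> 0) \<and> (\<forall>j<n. A $$ (i, j) \<noteq> 0 \<longrightarrow> j \<in> T)" for A :: "'a mat" and i
  proof -
    have "(\<lambda>j\<in>{..<n}. A $$ (i, j)) = (\<lambda>j\<in>{..<n}. 0) \<longleftrightarrow> (\<forall>j<n. A $$ (i, j) = 0)"
      by (auto simp: fun_eq_iff restrict_def)
    moreover have "(\<lambda>j\<in>{..<n}. A $$ (i, j)) \<in> Pi\<^sub>E {..<n} ?Y \<longleftrightarrow> (\<forall>j<n. A $$ (i, j) \<noteq> 0 \<longrightarrow> j \<in> T)"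
      by (auto simp: restrict_PiE_iff Pi_iff split: if_splits)
    ultimately show ?thesis by (simp add: X_def) blast
  qed
  have "{A :: 'a mat. A \<in> carrier_mat n n \<and> fst (support_pattern n A) = {..<n} \<and>
      snd (support_pattern n A) \<subseteq> T} = {A \<in> carrier_mat n n. \<forall>i<n. (\<lambda>j\<in>{..<n}. A $$ (i, j)) \<in> X}"
    unfolding row by (auto simp: support_pattern_def)
  moreover have "X \<subseteq> {..<n} \<rightarrow>\<^sub>E UNIV" by (auto simp: X_def)
  ultimately show ?thesis using card_mat_rows[of X n] cX by simp
qed

lemma card_mat_full_support:
  fixes n :: nat
  defines "F \<equiv> {A :: 'a::{finite, zero} mat. A \<in> carrier_mat n n \<and> support_pattern n A = ({..<n}, {..<n})}"
  shows "int (card F) = (\<Sum>k = 0..n. (- 1) ^ k * int (n choose k) * (int CARD('a) ^ (n - k) - 1) ^ n)"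
proof -
  let ?N = "{..<n}"
  define M where "M = {A :: 'a mat. A \<in> carrier_mat n n \<and> fst (support_pattern n A) = ?N}"
  have finM: "finite M" by (rule finite_subset[OF _ finite_carrier_mat]) (auto simp: M_def)
  let ?c = "\<lambda>A :: 'a mat. snd (support_pattern n A)"
  have c: "?c A \<subseteq> ?N" for A by (rule support_pattern_subset)
  have F: "F = {A \<in> M. ?c A = ?N}" by (auto simp: F_def M_def prod_eq_iff)
  have "int (card F) = (\<Sum>A \<in> M. if ?c A = ?N then 1 else 0)"
    using finM by (simp add: F sum.If_cases Int_def)
  \<comment> \<open>\<open>U\<close> runs over the sets of zero columns of \<open>A\<close>; the
    alternating sum is 1 if there are none and 0 otherwise.\<close>
  also have "\<dots> = (\<Sum>A \<in> M. \<Sum>U \<in> Pow (?N - ?c A). (- 1) ^ card U)"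
  proof (rule sum.cong)
    fix A
    have "?N - ?c A = {} \<longleftrightarrow> ?c A = ?N" using c[of A] by auto
    then show "(if ?c A = ?N then 1 else 0) = (\<Sum>U \<in> Pow (?N - ?c A). (- 1) ^ card U :: int)"
      by (simp add: sum_Pow_alternating)
  qed simp
  also have "\<dots> = (\<Sum>A \<in> M. \<Sum>U \<in> {U \<in> Pow ?N. ?c A \<subseteq> ?N - U}. (- 1) ^ card U)"
    using c by (intro sum.cong) blast+
  also have "\<dots> = (\<Sum>U \<in> Pow ?N. \<Sum>A \<in> {A \<in> M. ?c A \<subseteq> ?N - U}. (- 1) ^ card U)"
    using finM by (intro sum.swap_restrict) auto
  also have "\<dots> = (\<Sum>U \<in> Pow ?N. (- 1) ^ card U * (int CARD('a) ^ (n - card U) - 1) ^ n)"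
  proof (rule sum.cong)
    fix U assume U: "U \<in> Pow ?N"
    have "{A \<in> M. ?c A \<subseteq> ?N - U} = {A. A \<in> carrier_mat n n \<and> fst (support_pattern n A) = ?N \<and> ?c A \<subseteq> ?N - U}"
      by (auto simp: M_def)
    moreover have "card (?N - U) = n - card U" using U finite_subset[of U ?N] by (simp add: card_Diff_subset)
    ultimately have "card {A \<in> M. ?c A \<subseteq> ?N - U} = (CARD('a) ^ (n - card U) - 1) ^ n"
      using card_mat_full_rows[of "?N - U" n, where 'a = 'a] by simp
    moreover have "int (CARD('a) ^ m - 1) = int CARD('a) ^ m - 1" for m
      by (simp add: of_nat_diff)
    ultimately show "(\<Sum>A \<in> {A \<in> M. ?c A \<subseteq> ?N - U}. (- 1) ^ card U) =
        (- 1) ^ card U * (int CARD('a) ^ (n - card U) - 1) ^ n"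
      by simp
  qed simp
  also have "\<dots> = (\<Sum>k = 0..n. (- 1) ^ k * int (n choose k) * (int CARD('a) ^ (n - k) - 1) ^ n)"
    using sum_Pow_card[of ?N "\<lambda>k. (- 1) ^ k * (int CARD('a) ^ (n - k) - 1) ^ n"]
    by (simp add: mult.assoc mult.left_commute)
  finally show ?thesis .
qed

text \<open>The matrices left out are the zero matrix, which accounts for \<open>- 1\<close>, and
  those with neither a zero row nor a zero column. For \<open>n \<ge> 1\<close> the zero matrix is
  not among the latter.\<close>

lemma card_pattern_mats:
  assumes "n \<ge> 1"
  shows "int (card (pattern_mats TYPE('a::{finite, zero}) n)) = int CARD('a) ^ n\<^sup>2 - 1 -
    (\<Sum>k = 0..n. (- 1) ^ k * int (n choose k) * (int CARD('a) ^ (n - k) - 1) ^ n)"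
proof -
  let ?F = "{A :: 'a mat. A \<in> carrier_mat n n \<and> support_pattern n A = ({..<n}, {..<n})}"
  let ?Z = "0\<^sub>m n n :: 'a mat"
  have N: "{..<n} \<noteq> {}" using assms by (simp add: lessThan_empty_iff)
  have "pattern_mats TYPE('a) n = carrier_mat n n - insert ?Z ?F"
  proof (rule Set.set_eqI)
    fix A :: "'a mat"
    show "A \<in> pattern_mats TYPE('a) n \<longleftrightarrow> A \<in> carrier_mat n n - insert ?Z ?F"
    proof (cases "A \<in> carrier_mat n n")
      case True
      have "support_pattern n A \<in> patterns n \<longleftrightarrow> A \<noteq> ?Z \<and> support_pattern n A \<noteq> ({..<n}, {..<n})"
        using support_pattern_subset[of n A] support_pattern_eq_empty_iff[OF True]
        by (cases "support_pattern n A") (auto simp: patterns_def)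
      then show ?thesis using True by (simp add: pattern_mats_def)
    qed (simp add: pattern_mats_def)
  qed
  moreover have "insert ?Z ?F \<subseteq> carrier_mat n n" by auto
  moreover have "?Z \<notin> ?F"
    using support_pattern_eq_empty_iff(1)[of ?Z n] N by auto
  moreover have "finite ?F" by (rule finite_subset[OF _ finite_carrier_mat]) auto
  moreover have "card (insert ?Z ?F) \<le> card (carrier_mat n n :: 'a mat set)"
    by (rule card_mono[OF finite_carrier_mat]) auto
  ultimately have "int (card (pattern_mats TYPE('a) n)) = int (card (carrier_mat n n :: 'a mat set)) - (1 + int (card ?F))"
    by (simp add: card_Diff_subset of_nat_diff)
  then show ?thesis by (simp add: card_carrier_mat card_mat_full_support)
qed

section \<open>Metric dimensions\<close>

instance boolean :: semiring_1_no_zero_divisors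
proof
  fix a b :: boolean
  assume "a \<noteq> 0" "b \<noteq> 0"
  then show "a * b \<noteq> 0"
    by (cases a; cases b; simp add: zero_boolean_def times_boolean_def)
qed

lemma antinegative_boolean: "antinegative TYPE(boolean)"
  unfolding antinegative_def by (simp add: zero_boolean_def plus_boolean_def)

lemma boolean_neq_0 [simp]: "x \<noteq> 0 \<longleftrightarrow> x = (1 :: boolean)"
  by (cases x) (simp_all add: zero_boolean_def one_boolean_def)

lemma card_boolean: "CARD(boolean) = 2"
  by (simp add: UNIV_boolean)

lemma pattern_dist_pos: "0 < pattern_dist n p q"
  by (cases p; cases q) simp

lemma metric_dimension_eqI:
  assumes "resolving_set G W" "\<And>W'. resolving_set G W' \<Longrightarrow> card W \<le> card W'"
  shows "metric_dimension G = card W"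
  unfolding metric_dimension_def by (rule Least_equality) (use assms in auto)

lemma finite_pattern_mats: "finite (pattern_mats TYPE('a::{finite, zero}) n)"
  by (rule finite_subset[OF _ finite_carrier_mat]) (auto simp: pattern_mats_def)

section \<open>Resolving sets in terms of patterns\<close>

text \<open>A vertex of \<open>W\<close> is at distance 0 from itself and from no other vertex, so
  only pairs outside \<open>W\<close> matter. Their distances to \<open>W\<close> are pattern
  distances, which cannot separate two vertices of equal pattern.\<close>

lemma resolving_set_mat_graph_iff:
  fixes n :: nat
  assumes S: "antinegative TYPE('a::{finite, semiring_1_no_zero_divisors})"
  defines "V \<equiv> pattern_mats TYPE('a) n"
  shows "resolving_set (mat_graph TYPE('a) n) W \<longleftrightarrow> W \<subseteq> V \<and> inj_on (support_pattern n) (V - W) \<and>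
    separates n (support_pattern n ` W) (support_pattern n ` (V - W))"
proof -
  let ?G = "mat_graph TYPE('a) n" and ?s = "support_pattern n"
  let ?d = "\<lambda>A B :: 'a mat. if A = B then 0 else pattern_dist n (?s A) (?s B)"
  have dist: "graph_dist ?G A B = graph_dist ?G A' B \<longleftrightarrow> ?d A B = ?d A' B"
    if "A \<in> V" "A' \<in> V" "B \<in> V" for A A' B
    using that by (simp add: V_def graph_dist_mat_graph[OF S])
  have res: "resolving_set ?G W \<longleftrightarrow> W \<subseteq> V \<and>
      (\<forall>A \<in> V. \<forall>B \<in> V. A \<noteq> B \<longrightarrow> (\<exists>C \<in> W. ?d A C \<noteq> ?d B C))"
  proof -
    have "resolving_set ?G W \<longleftrightarrow> finite W \<and> W \<subseteq> V \<and>
        (\<forall>A \<in> V. \<forall>B \<in> V. A \<noteq> B \<longrightarrow> (\<exists>C \<in> W. graph_dist ?G A C \<noteq> graph_dist ?G B C))"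
      by (simp only: resolving_set_def with_proj_simps pverts_mat_graph[OF S] V_def)
    moreover have "finite W" and "(\<forall>A \<in> V. \<forall>B \<in> V. A \<noteq> B \<longrightarrow> (\<exists>C \<in> W. graph_dist ?G A C \<noteq> graph_dist ?G B C)) \<longleftrightarrow>
        (\<forall>A \<in> V. \<forall>B \<in> V. A \<noteq> B \<longrightarrow> (\<exists>C \<in> W. ?d A C \<noteq> ?d B C))" if W: "W \<subseteq> V"
    proof -
      show "finite W" using W finite_pattern_mats finite_subset unfolding V_def by blast
      have cmp: "graph_dist ?G A C \<noteq> graph_dist ?G B C \<longleftrightarrow> ?d A C \<noteq> ?d B C"
        if "A \<in> V" "B \<in> V" "C \<in> W" for A B C
        using dist[OF that(1,2), of C] that(3) W by (simp only: subset_iff)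
      show "(\<forall>A \<in> V. \<forall>B \<in> V. A \<noteq> B \<longrightarrow> (\<exists>C \<in> W. graph_dist ?G A C \<noteq> graph_dist ?G B C)) \<longleftrightarrow>
          (\<forall>A \<in> V. \<forall>B \<in> V. A \<noteq> B \<longrightarrow> (\<exists>C \<in> W. ?d A C \<noteq> ?d B C))"
        by (intro ball_cong imp_cong bex_cong refl cmp)
    qed
    ultimately show ?thesis by argo
  qed
  show ?thesis
  proof
    assume r: "resolving_set ?G W"
    then have W: "W \<subseteq> V" and ex: "\<And>A B. A \<in> V \<Longrightarrow> B \<in> V \<Longrightarrow> A \<noteq> B \<Longrightarrow> \<exists>C \<in> W. ?d A C \<noteq> ?d B C"
      unfolding res by blast+
    have ex': "\<exists>C \<in> W. pattern_dist n (?s A) (?s C) \<noteq> pattern_dist n (?s B) (?s C)"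
      if AB: "A \<in> V - W" "B \<in> V - W" "A \<noteq> B" for A B
    proof -
      obtain C where C: "C \<in> W" "?d A C \<noteq> ?d B C" using ex AB by blast
      then have "A \<noteq> C" "B \<noteq> C" using AB by auto
      then show ?thesis using C by auto
    qed
    have "inj_on ?s (V - W)"
    proof (rule inj_onI, rule ccontr)
      fix A B assume "A \<in> V - W" "B \<in> V - W" "?s A = ?s B" "A \<noteq> B"
      then show False using ex'[of A B] by simp
    qed
    moreover have "separates n (?s ` W) (?s ` (V - W))"
      unfolding separates_def
    proof (intro ballI impI)
      fix p q assume pq: "p \<in> ?s ` (V - W)" "q \<in> ?s ` (V - W)" "p \<noteq> q"
      then obtain A B where "A \<in> V - W" "p = ?s A" "B \<in> V - W" "q = ?s B" by blast
      then show "\<exists>t \<in> ?s ` W. pattern_dist n p t \<noteq> pattern_dist n q t"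
        using ex'[of A B] pq(3) by blast
    qed
    ultimately show "W \<subseteq> V \<and> inj_on ?s (V - W) \<and> separates n (?s ` W) (?s ` (V - W))" using W by blast
  next
    assume "W \<subseteq> V \<and> inj_on ?s (V - W) \<and> separates n (?s ` W) (?s ` (V - W))"
    then have W: "W \<subseteq> V" and inj: "inj_on ?s (V - W)" and sep: "separates n (?s ` W) (?s ` (V - W))"
      by blast+
    have "\<exists>C \<in> W. ?d A C \<noteq> ?d B C" if AB: "A \<in> V" "B \<in> V" "A \<noteq> B" for A B
    proof -
      consider "A \<in> W" | "B \<in> W" | "A \<in> V - W" "B \<in> V - W" using AB by blast
      then show ?thesis
      proof cases
        case 1
        then show ?thesis using AB(3)[symmetric] by (intro bexI[of _ A]) (simp_all add: pattern_dist_pos)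
      next
        case 2
        then show ?thesis using AB(3) by (intro bexI[of _ B]) (simp_all add: pattern_dist_pos)
      next
        case 3
        then have "?s A \<noteq> ?s B" using inj AB(3) by (meson inj_onD)
        then obtain t where "t \<in> ?s ` W" "pattern_dist n (?s A) t \<noteq> pattern_dist n (?s B) t"
          using separatesD[OF sep] 3 by (metis imageI)
        then obtain C where "C \<in> W" "pattern_dist n (?s A) (?s C) \<noteq> pattern_dist n (?s B) (?s C)" by blast
        moreover from this 3 have "A \<noteq> C" "B \<noteq> C" by blast+
        ultimately show ?thesis by (intro bexI[of _ C]) simp_all
      qed
    qed
    then show "resolving_set ?G W" unfolding res using W by blast
  qed
qed

text \<open>For each pattern in \<open>Q\<close> the block matrix with entry 1 is omitted. The
  assumption \<open>other\<close> ensures that each test pattern in \<open>P\<close> keeps a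
  carrier: its own block matrix or a different matrix.\<close>

lemma resolving_set_omit_blocks:
  assumes S: "antinegative TYPE('a::{finite, semiring_1_no_zero_divisors})"
    and Q: "Q \<subseteq> patterns n" and sep: "separates n P Q" and P: "P \<subseteq> patterns n"
    and other: "\<And>p. p \<in> P \<Longrightarrow> p \<notin> Q \<or> (\<exists>A \<in> carrier_mat n n. support_pattern n A = p \<and> A \<noteq> block_mat n (1 :: 'a) p)"
  shows "\<exists>W. resolving_set (mat_graph TYPE('a) n) W \<and> card W + card Q = card (pattern_mats TYPE('a) n)"
proof -
  let ?V = "pattern_mats TYPE('a) n" and ?b = "block_mat n (1 :: 'a)" and ?s = "support_pattern n"
  define W where "W = ?V - ?b ` Q"
  have sb: "?s (?b p) = p" if "p \<in> patterns n" for p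
    using that by (rule support_pattern_block_mat) simp
  have bV: "?b p \<in> ?V" if "p \<in> patterns n" for p
    using sb[OF that] that by (simp add: pattern_mats_def)
  have VW: "?V - W = ?b ` Q" using bV Q by (auto simp: W_def)
  have injb: "inj_on ?b Q"
  proof (rule inj_onI)
    fix p q assume "p \<in> Q" "q \<in> Q" "?b p = ?b q"
    then show "p = q" using sb[of p] sb[of q] Q by auto
  qed
  have img: "?s ` (?V - W) = Q" unfolding VW image_image using sb Q by force
  have "inj_on ?s (?V - W)" unfolding VW using sb Q by (auto simp: inj_on_def subset_iff)
  moreover have "P \<subseteq> ?s ` W"
  proof
    fix p assume p: "p \<in> P"
    then have pp: "p \<in> patterns n" using P by blast
    from other[OF p] show "p \<in> ?s ` W"
    proof
      assume "p \<notin> Q"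
      have "?b p \<noteq> ?b q" if "q \<in> Q" for q
        using sb[OF pp] sb[of q] that Q \<open>p \<notin> Q\<close> by (metis subsetD)
      then have "?b p \<in> W" using bV[OF pp] by (auto simp: W_def)
      then show ?thesis using sb[OF pp] by (metis imageI)
    next
      assume "\<exists>A \<in> carrier_mat n n. ?s A = p \<and> A \<noteq> ?b p"
      then obtain A where A: "A \<in> carrier_mat n n" "?s A = p" "A \<noteq> ?b p" by blast
      have "A \<noteq> ?b q" if "q \<in> Q" for q using A(2,3) sb[of q] that Q by (metis subsetD)
      moreover have "A \<in> ?V" using A pp by (simp add: pattern_mats_def)
      ultimately have "A \<in> W" unfolding W_def by blast
      then show ?thesis using A(2) by blast
    qed
  qed
  then have "separates n (?s ` W) (?s ` (?V - W))"
    unfolding img using separates_mono[OF sep] by blast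
  moreover have "W \<subseteq> ?V" by (auto simp: W_def)
  ultimately have "resolving_set (mat_graph TYPE('a) n) W"
    unfolding resolving_set_mat_graph_iff[OF S] by blast
  moreover have "card W + card Q = card ?V"
  proof -
    have "card Q = card (?V - W)" unfolding VW by (rule card_image[OF injb, symmetric])
    moreover have "card ?V = card W + card (?V - W)"
      using \<open>W \<subseteq> ?V\<close> finite_pattern_mats[of n, where 'a = 'a]
      by (subst card_Un_disjoint[symmetric]) (auto intro: finite_subset arg_cong[of _ _ card])
    ultimately show ?thesis by simp
  qed
  ultimately show ?thesis by blast
qed

lemma card_resolving_set_mat_graph:
  assumes S: "antinegative TYPE('a::{finite, semiring_1_no_zero_divisors})"
    and W: "resolving_set (mat_graph TYPE('a) n) W"
  defines "Q \<equiv> support_pattern n ` (pattern_mats TYPE('a) n - W)"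
  shows "card W + card Q = card (pattern_mats TYPE('a) n)" "Q \<subseteq> patterns n"
proof -
  let ?V = "pattern_mats TYPE('a) n"
  have WV: "W \<subseteq> ?V" and "inj_on (support_pattern n) (?V - W)"
    using W unfolding resolving_set_mat_graph_iff[OF S] by blast+
  then have "card Q = card (?V - W)" unfolding Q_def by (intro card_image)
  moreover have "card ?V = card W + card (?V - W)"
    using WV finite_pattern_mats[of n, where 'a = 'a]
    by (subst card_Un_disjoint[symmetric]) (auto intro: finite_subset arg_cong[of _ _ card])
  ultimately show "card W + card Q = card ?V" by simp
  show "Q \<subseteq> patterns n" by (auto simp: Q_def pattern_mats_def)
qed

text \<open>An element \<open>a\<close> different from 0 and 1 gives each pattern a second carrier,
  so all patterns can be omitted once and still serve as tests. No resolving set can omit more,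
  since the patterns of its omitted vertices are distinct.\<close>

lemma metric_dimension_mat_graph_large:
  assumes S: "antinegative TYPE('a::{finite, semiring_1_no_zero_divisors})"
    and q: "CARD('a) \<ge> 3" and n: "n \<ge> 2"
  shows "metric_dimension (mat_graph TYPE('a) n) + card (patterns n) = card (pattern_mats TYPE('a) n)"
proof -
  have "\<exists>a :: 'a. a \<noteq> 0 \<and> a \<noteq> 1"
  proof (rule ccontr)
    assume "\<not> ?thesis"
    then have "(UNIV :: 'a set) = {0, 1}" by auto
    then have "CARD('a) = card {0 :: 'a, 1}" by (rule arg_cong)
    then show False using q by simp
  qed
  then obtain a :: 'a where a: "a \<noteq> 0" "a \<noteq> 1" by blast
  have "block_mat n a p \<noteq> block_mat n 1 p" if p: "p \<in> patterns n" for p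
  proof -
    have "fst p \<subseteq> {..<n}" "snd p \<subseteq> {..<n}" "fst p \<noteq> {}" "snd p \<noteq> {}" using p by (auto simp: patterns_def)
    then obtain i j where "i \<in> fst p" "j \<in> snd p" "i < n" "j < n" by blast
    then have "block_mat n a p $$ (i, j) \<noteq> block_mat n 1 p $$ (i, j)" using a by (simp add: block_mat_def)
    then show ?thesis by metis
  qed
  then have other: "p \<notin> patterns n \<or> (\<exists>A \<in> carrier_mat n n. support_pattern n A = p \<and> A \<noteq> block_mat n (1 :: 'a) p)"
    if "p \<in> patterns n" for p
    using that support_pattern_block_mat[OF that a(1)] block_mat_carrier by blast
  obtain W where W: "resolving_set (mat_graph TYPE('a) n) W"
    "card W + card (patterns n) = card (pattern_mats TYPE('a) n)"
    using resolving_set_omit_blocks[OF S subset_refl separates_patterns[OF n] subset_refl other] by blast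
  have "metric_dimension (mat_graph TYPE('a) n) = card W"
  proof (rule metric_dimension_eqI[OF W(1)])
    fix W' assume "resolving_set (mat_graph TYPE('a) n) W'"
    note * = card_resolving_set_mat_graph[OF S this]
    show "card W \<le> card W'" using card_mono[OF finite_patterns *(2)] *(1) W(2) by linarith
  qed
  then show ?thesis using W(2) by simp
qed

lemma boolean_mat_eqI:
  fixes A B :: "boolean mat"
  assumes A: "A \<in> carrier_mat n n" and B: "B \<in> carrier_mat n n"
    and eq: "support_pattern n A = support_pattern n B"
    and thin: "card (fst (support_pattern n A)) = 1 \<or> card (snd (support_pattern n A)) = 1"
  shows "A = B"
proof -
  have entry: "M $$ (i, j) = 1 \<longleftrightarrow> i \<in> fst (support_pattern n M) \<and> j \<in> snd (support_pattern n M)"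
    if ij: "i < n" "j < n" and thin: "card (fst (support_pattern n M)) = 1 \<or> card (snd (support_pattern n M)) = 1"
    for M :: "boolean mat" and i j
  proof
    assume "M $$ (i, j) = 1"
    then show "i \<in> fst (support_pattern n M) \<and> j \<in> snd (support_pattern n M)"
      using ij by (auto simp: support_pattern_def)
  next
    assume *: "i \<in> fst (support_pattern n M) \<and> j \<in> snd (support_pattern n M)"
    then obtain i' j' where i': "j' < n" "M $$ (i, j') = 1" and j': "i' < n" "M $$ (i', j) = 1"
      by (auto simp: support_pattern_def)
    then have "j' \<in> snd (support_pattern n M)" "i' \<in> fst (support_pattern n M)"
      using ij by (auto simp: support_pattern_def)
    \<comment> \<open>The row and the column through \<open>(i, j)\<close> contain entries 1 at
      \<open>(i, j')\<close> and \<open>(i', j)\<close>; with a single nonzero row or column one of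
      these is the entry at \<open>(i, j)\<close>.\<close>
    with thin * have "i = i' \<or> j = j'" by (auto simp: card_1_singleton_iff)
    then show "M $$ (i, j) = 1" using i' j' by blast
  qed
  show ?thesis
  proof (rule eq_matI)
    fix i j assume "i < dim_row B" "j < dim_col B"
    then have "A $$ (i, j) = 1 \<longleftrightarrow> B $$ (i, j) = 1" using entry[of i j A] entry[of i j B] B eq thin by auto
    then show "A $$ (i, j) = B $$ (i, j)" by (metis boolean_neq_0)
  qed (use A B in auto)
qed

text \<open>Deleting one entry from the full block keeps the pattern, because its row and its column
  each retain another nonzero entry.\<close>

lemma ex_other_mat_with_thick_pattern:
  assumes "p \<in> thick_patterns n"
  shows "\<exists>A \<in> carrier_mat n n. support_pattern n A = p \<and> A \<noteq> block_mat n (1 :: 'a::zero_neq_one) p"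
proof -
  obtain R C where p: "p = (R, C)" by fastforce
  have sub: "R \<subseteq> {..<n}" "C \<subseteq> {..<n}" and two: "card R \<ge> 2" "card C \<ge> 2"
    using assms by (auto simp: p thick_patterns_def patterns_def)
  have ex2: "\<exists>x y. x \<in> X \<and> y \<in> X \<and> x \<noteq> y" if "card X \<ge> 2" for X :: "nat set"
    using that card_le_Suc0_iff_eq[of X] by (cases "finite X") fastforce+
  obtain r r' where r: "r \<in> R" "r' \<in> R" "r \<noteq> r'" using ex2[OF two(1)] by blast
  obtain c c' where c: "c \<in> C" "c' \<in> C" "c \<noteq> c'" using ex2[OF two(2)] by blast
  have lt: "r < n" "r' < n" "c < n" "c' < n" using r c sub by auto
  define A where "A = mat n n (\<lambda>(i, j). if i \<in> R \<and> j \<in> C \<and> (i, j) \<noteq> (r, c) then 1 else (0 :: 'a))"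
  have entry: "A $$ (i, j) \<noteq> 0 \<longleftrightarrow> i \<in> R \<and> j \<in> C \<and> (i, j) \<noteq> (r, c)" if "i < n" "j < n" for i j
    using that by (simp add: A_def)
  have "fst (support_pattern n A) = R"
  proof (intro equalityI subsetI)
    fix i assume "i \<in> fst (support_pattern n A)"
    then obtain j where "i < n" "j < n" "A $$ (i, j) \<noteq> 0" by (auto simp: support_pattern_def)
    then show "i \<in> R" using entry by simp
  next
    fix i assume i: "i \<in> R"
    then have "i < n" using sub by blast
    then have "A $$ (i, c') \<noteq> 0" using entry[of i c'] i c lt by simp
    then show "i \<in> fst (support_pattern n A)" using \<open>i < n\<close> lt by (auto simp: support_pattern_def)
  qed
  moreover have "snd (support_pattern n A) = C"
  proof (intro equalityI subsetI)
    fix j assume "j \<in> snd (support_pattern n A)"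
    then obtain i where "i < n" "j < n" "A $$ (i, j) \<noteq> 0" by (auto simp: support_pattern_def)
    then show "j \<in> C" using entry by simp
  next
    fix j assume j: "j \<in> C"
    then have "j < n" using sub by blast
    then have "A $$ (r', j) \<noteq> 0" using entry[of r' j] j r lt by simp
    then show "j \<in> snd (support_pattern n A)" using \<open>j < n\<close> lt by (auto simp: support_pattern_def)
  qed
  moreover have "A $$ (r, c) \<noteq> block_mat n 1 p $$ (r, c)"
    using lt r c by (simp add: A_def block_mat_def p)
  moreover have "A \<in> carrier_mat n n" by (simp add: A_def)
  ultimately show ?thesis unfolding p by (metis prod.collapse)
qed

lemma metric_dimension_mat_graph_boolean:
  assumes n: "n \<ge> 2"
  shows "metric_dimension (mat_graph TYPE(boolean) n) + card (patterns n) =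
    card (pattern_mats TYPE(boolean) n) + 2 * (n - 1)"
proof -
  let ?G = "mat_graph TYPE(boolean) n" and ?V = "pattern_mats TYPE(boolean) n" and ?s = "support_pattern n"
  note S = antinegative_boolean
  let ?Q = "patterns n - thin_tests n"
  have sub: "thick_patterns n \<union> thin_tests n \<subseteq> patterns n"
    using thin_tests_subset_patterns[OF n] by (auto simp: thick_patterns_def)
  have "p \<notin> ?Q \<or> (\<exists>A \<in> carrier_mat n n. ?s A = p \<and> A \<noteq> block_mat n (1 :: boolean) p)"
    if "p \<in> thick_patterns n \<union> thin_tests n" for p
    using that ex_other_mat_with_thick_pattern[of p n, where 'a = boolean] by blast
  then obtain W where W: "resolving_set ?G W" "card W + card ?Q = card ?V"
    using resolving_set_omit_blocks[OF S Diff_subset separates_thick_Un_thin[OF n] sub] by blast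
  have Q: "card ?Q + 2 * (n - 1) = card (patterns n)"
    using card_Diff_subset[OF _ thin_tests_subset_patterns[OF n]] finite_patterns[of n]
      card_mono[OF finite_patterns thin_tests_subset_patterns[OF n]]
      finite_subset[OF thin_tests_subset_patterns[OF n] finite_patterns]
    by (simp add: card_thin_tests[OF n])
  have "metric_dimension ?G = card W"
  proof (rule metric_dimension_eqI[OF W(1)])
    fix W' assume W': "resolving_set ?G W'"
    let ?Q' = "?s ` (?V - W')"
    note c = card_resolving_set_mat_graph[OF S W']
    have W'V: "W' \<subseteq> ?V" and sep: "separates n (?s ` W') ?Q'"
      using W' unfolding resolving_set_mat_graph_iff[OF S] by blast+
    have P: "?s ` W' \<subseteq> patterns n" using W'V by (auto simp: pattern_mats_def)
    have PQ: "patterns n \<subseteq> ?s ` W' \<union> ?Q'"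
    proof
      fix p assume "p \<in> patterns n"
      then obtain A :: "boolean mat" where "A \<in> ?V" "?s A = p" by (rule ex_mat_with_pattern)
      then show "p \<in> ?s ` W' \<union> ?Q'" by blast
    qed
    have thin: "p \<notin> ?Q'" if p: "p \<in> ?s ` W'" "card (fst p) = 1 \<or> card (snd p) = 1" for p
    proof
      assume "p \<in> ?Q'"
      then obtain A where A: "A \<in> ?V" "A \<notin> W'" "p = ?s A" by blast
      from p obtain B where B: "B \<in> W'" "p = ?s B" by blast
      \<comment> \<open>A Boolean matrix with a single nonzero row or column is determined by its
        pattern, so the kept and the omitted carrier would be the same vertex.\<close>
      have "A = B" using A B W'V p by (intro boolean_mat_eqI[of A n B]) (auto simp: pattern_mats_def)
      then show False using A B by blast
    qed
    have "2 * (n - 1) \<le> card (patterns n - ?Q')" by (rule separates_lower_bound[OF n P PQ sep thin])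
    moreover have "card (patterns n - ?Q') = card (patterns n) - card ?Q'"
      using c(2) finite_patterns finite_subset by (intro card_Diff_subset) blast+
    ultimately show "card W \<le> card W'" using c(1) W(2) Q card_mono[OF finite_patterns c(2)] by linarith
  qed
  then show ?thesis using W(2) Q by linarith
qed

theorem theorem4p4:
  fixes n :: nat
  assumes "antinegative TYPE('a :: {finite, semiring_1_no_zero_divisors})"
    and "CARD('a) \<ge> 3"
    and "n \<ge> 2"
  shows
    "int (metric_dimension (with_proj (zero_divisor_graph (ring_mat TYPE('a) n ()))))
     = int CARD('a) ^ (n\<^sup>2) - 2 ^ (n\<^sup>2)
       - (\<Sum>k = 0..n. (-1) ^ k * int (n choose k) *
            ((int CARD('a) ^ (n - k) - 1) ^ n - (2 ^ (n - k) - 1) ^ n))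
       + int (metric_dimension (with_proj (zero_divisor_graph (ring_mat TYPE(boolean) n ()))))
       - 2 * (int n - 1)"
proof -
  let ?f = "\<lambda>q. \<Sum>k = 0..n. (-1) ^ k * int (n choose k) * (q ^ (n - k) - 1) ^ n :: int"
  have "int (card (pattern_mats TYPE('a) n)) = int CARD('a) ^ n\<^sup>2 - 1 - ?f (int CARD('a))"
    and "int (card (pattern_mats TYPE(boolean) n)) = 2 ^ n\<^sup>2 - 1 - ?f 2"
    using card_pattern_mats[of n, where 'a = 'a] card_pattern_mats[of n, where 'a = boolean] assms(3)
    by (simp_all add: card_boolean)
  moreover have "(\<Sum>k = 0..n. (-1) ^ k * int (n choose k) *
      ((int CARD('a) ^ (n - k) - 1) ^ n - (2 ^ (n - k) - 1) ^ n)) = ?f (int CARD('a)) - ?f 2"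
    by (simp only: right_diff_distrib sum_subtractf)
  moreover have "int (metric_dimension (mat_graph TYPE('a) n)) =
      int (card (pattern_mats TYPE('a) n)) - int (card (patterns n))"
    using metric_dimension_mat_graph_large[OF assms] by linarith
  moreover have "int (metric_dimension (mat_graph TYPE(boolean) n)) =
      int (card (pattern_mats TYPE(boolean) n)) + 2 * (int n - 1) - int (card (patterns n))"
    using arg_cong[OF metric_dimension_mat_graph_boolean[OF assms(3)], of int] assms(3)
    by (simp add: of_nat_diff)
  \<comment> \<open>Here \<open>a\<close> and \<open>b\<close> are the numbers of all matrices,
    \<open>f\<close> and \<open>g\<close> the numbers of those with full support, \<open>m\<close>
    is the dimension \<open>n\<close>, and \<open>p\<close> is the number of patterns, which
    cancels.\<close>
  moreover have "a - 1 - f - p = a - b - (f - g) + (b - 1 - g + 2 * (m - 1) - p) - 2 * (m - 1)"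
    for a b f g m p :: int
    by simp
  ultimately show ?thesis by (simp only:)
qed

end
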